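(* For $i=1,2$ let $\mathfrak g_i=\mathfrak h_i\oplus\mathfrak m_i$ be naturally reductive decompositions with $\mathfrak g_i$ their transvection algebras and with $\mathfrak g_i$ of the form $$\mathfrak g_i=\mathfrak h_i\oplus\mathfrak m_{0,i}\oplus_{L.a.}\mathbb R^{n_i},\qquad \mathfrak m_i=\mathfrak m_{0,i}\oplus\mathbb R^{n_i},$$ where $\mathfrak h_i\oplus\mathfrak m_{0,i}$ is semisimple or $\{0\}$. Let $\mathfrak k_i\subset\mathfrak s(\mathfrak g_i)$ be a finite-dimensional subalgebra with an $\mathrm{ad}(\mathfrak k_i)$-invariant inner product $B_i$, and let $\mathfrak f_i$ be the transvection algebra of the $(\mathfrak k_i,B_i)$-extension of $\mathfrak g_i=\mathfrak h_i\oplus\mathfrak m_i$. Suppose that $\mathfrak g_i=\mathfrak h_i\oplus\mathfrak m_i$ is the canonical base space of the $(\mathfrak k_i,B_i)$-extension for $i=1,2$ and that the $(\mathfrak k_1,B_1)$-extension and the $(\mathfrak k_2,B_2)$-extension are isomorphic. Then there is a Lie algebra isomorphism $\tau:\mathfrak g_1\to\mathfrak g_2$ such that $\tau(\mathfrak h_1)=\mathfrak h_2$, $\tau|_{\mathfrak m_1}:\mathfrak m_1\to\mathfrak m_2$ is an isometry, and $\tau_*:\mathfrak k_1\to\mathfrak k_2$ is an isometry (with respect to $B_1,B_2$), where $\tau_*:\mathrm{Der}(\mathfrak g_1)\to\mathrm{Der}(\mathfrak g_2)$, $\tau_*(f)=\tau\circ f\circ\tau^{-1}$, is the induced map on deri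vations.
   Context: Lie algebras are real and finite-dimensional; $\oplus_{L.a.}$ is a direct sum of Lie algebras. A naturally reductive decomposition $(\mathfrak g=\mathfrak h\oplus\mathfrak m,g)$ is a Lie algebra $\mathfrak g$ with a subalgebra $\mathfrak h$ (the isotropy algebra), a complement $\mathfrak m$ and an inner product $g$ on $\mathfrak m$ such that $[\mathfrak h,\mathfrak m]\subset\mathfrak m$, $g$ is $\mathrm{ad}(\mathfrak h)$-invariant, and $g([x,y]_{\mathfrak m},z)=-g(y,[x,z]_{\mathfrak m})$ for $x,y,z\in\mathfrak m$. Its infinitesimal model is $(T,R)$ with $T(x,y)=-[x,y]_{\mathfrak m}$, $R(x,y)=-\mathrm{ad}([x,y]_{\mathfrak h})\in\mathfrak{so}(\mathfrak m)$. $\mathfrak g$ is its transvection algebra if $\mathrm{ad}:\mathfrak h\to\mathfrak{so}(\mathfrak m)$ is injective and $\mathrm{im}(R)=\mathrm{ad}(\mathfrak h)$. Two infinitesimal models are isomorphic if there is a linear isometry carrying one pair $(T,R)$ to the other. For $\mathfrak g=\mathfrak h\oplus\mathfrak m$ with $\mathfrak g\neq\{0\}$ its transvection algebra, $\mathfrak s(\mathfrak g)=\{f\in\mathrm{Der}(\mathfrak g):f(\mathfrak h)=\{0\},f(\mathfrak m)\subset\mathfrak m,f|_{\mathfrak m}\in\mathfrak{so}(\mathfrak m)\}$; $\mathfrak s(\{0\})=\mathfrak{so}(\infty)$. Let $\mathfrak k\subset\mathfrak s(\mathfrak g)$ be finite-dimensional with $\mathrm{ad}(\mathfrak k)$-invariant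 inner product $B$, and $(T_0,R_0)$, $g_0$ the infinitesimal model and metric of $\mathfrak g=\mathfrak h\oplus\mathfrak m$. Let $\mathfrak n$ be a copy of $\mathfrak k$ with inner product $B$, $\varphi:\mathfrak k\to\mathfrak{so}(\mathfrak m)$ the natural representation, $\psi=\mathrm{ad}\oplus\varphi:\mathfrak k\to\mathfrak{so}(\mathfrak n\oplus\mathfrak m)$, $k_1,\dots,k_l$ an orthonormal basis of $\mathfrak k$, $n_i\in\mathfrak n$ corresponding to $k_i$. The $(\mathfrak k,B)$-extension is the infinitesimal model on $(\mathfrak n\oplus\mathfrak m,B\oplus g_0)$ given by $T=T_0+\sum_i\varphi(k_i)\wedge n_i+2T_{\mathfrak n}$, $R=R_0+\sum_i\psi(k_i)\odot\psi(k_i)$, where $T_{\mathfrak n}(x,y,z)=B([x,y],z)$, $T_0,R_0$ are extended by zero, skew endomorphisms are identified with 2-forms by $\alpha(x,y)=\langle\alpha x,y\rangle$, and $(\alpha\odot\alpha)(x,y)=\langle\alpha x,y\rangle\alpha$. Its transvection algebra is $\mathfrak f=\mathrm{im}(R)\oplus\mathfrak n\oplus\mathfrak m$ with bracket $[A+x,C+y]=[A,C]-R(x,y)+A(y)-C(x)-T(x,y)$ for $A,C\in\mathrm{im}(R)$, $x,y\in\mathfrak n\oplus\mathfrak m$. $\mathfrak g=\mathfrak h\oplus\mathfrak m$ is the canonical base space of its $(\mathfrak k,B)$-extension if the maximal abelian ideal $\mathfrak d$ of $\mathfrak f$ (which exists: it is the sum of all abelian ideals) satisfies $\pi_{\mathfrak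 n\oplus\mathfrak m}(\mathfrak d)=\mathfrak n$, where $\pi_{\mathfrak n\oplus\mathfrak m}$ is the projection along $\mathrm{im}(R)$. If $\mathfrak g_1=\mathfrak g_2=\{0\}$, the assertion about $\tau_*$ is understood as: there is an isometric Lie algebra isomorphism $(\mathfrak k_1,B_1)\to(\mathfrak k_2,B_2)$. *)

theory Defs
  imports "HOL-Analysis.Analysis" "HOL-Library.Function_Algebras"
begin

section \<open>Linear algebra on subspaces\<close>

text \<open>Functions into a real vector space form a real vector space under pointwise operations.\<close>

instantiation "fun" :: (type, real_vector) real_vector
begin

definition scaleR_fun :: "real \<Rightarrow> ('a \<Rightarrow> 'b) \<Rightarrow> 'a \<Rightarrow> 'b"
  where "scaleR_fun c f = (\<lambda>x. c *\<^sub>R f x)"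

instance
  by standard (auto simp: scaleR_fun_def fun_eq_iff plus_fun_def scaleR_add_right scaleR_add_left)

end

text \<open>Every vector space below is a subspace of some ambient real vector space. Linear
  endomorphisms of a subspace \<open>V\<close> are normalised to vanish off \<open>V\<close>, so that equality of
  endomorphisms of \<open>V\<close> is equality of functions.\<close>

definition finite_dim :: "'a::real_vector set \<Rightarrow> bool" where
  "finite_dim V \<longleftrightarrow> (\<exists>E. finite E \<and> span E = V)"

definition lin_map_on :: "'a::real_vector set \<Rightarrow> 'b::real_vector set \<Rightarrow> ('a \<Rightarrow> 'b) \<Rightarrow> bool" where
  "lin_map_on V W f \<longleftrightarrow>
     f ` V \<subseteq> W \<and>
     (\<forall>x\<in>V. \<forall>y\<in>V. f (x + y) = f x + f y) \<and>
     (\<forall>c. \<forall>x\<in>V. f (c *\<^sub>R x) = c *\<^sub>R f x)"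

definition zero_off :: "'a set \<Rightarrow> ('a \<Rightarrow> 'b::zero) \<Rightarrow> 'a \<Rightarrow> 'b" where
  "zero_off V f = (\<lambda>x. if x \<in> V then f x else 0)"

definition endos :: "'a::real_vector set \<Rightarrow> ('a \<Rightarrow> 'a) set" where
  "endos V = {f. lin_map_on V V f \<and> (\<forall>x. x \<notin> V \<longrightarrow> f x = 0)}"

definition commutator :: "('a::real_vector \<Rightarrow> 'a) \<Rightarrow> ('a \<Rightarrow> 'a) \<Rightarrow> 'a \<Rightarrow> 'a" where
  "commutator f h = (\<lambda>x. f (h x) - h (f x))"

definition sum_space :: "'a::real_vector set \<Rightarrow> 'a set \<Rightarrow> 'a set" where
  "sum_space U W = {u + w | u w. u \<in> U \<and> w \<in> W}"

definition direct_sum_of :: "'a::real_vector set \<Rightarrow> 'a set \<Rightarrow> 'a set \<Rightarrow> bool" where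
  "direct_sum_of V U W \<longleftrightarrow> subspace U \<and> subspace W \<and> U \<inter> W = {0} \<and> V = sum_space U W"

text \<open>The projection onto \<open>W\<close> along \<open>U\<close>, for arguments in \<open>U \<oplus> W\<close>.\<close>

definition proj_along :: "'a::real_vector set \<Rightarrow> 'a set \<Rightarrow> 'a \<Rightarrow> 'a" where
  "proj_along U W x = (THE w. w \<in> W \<and> x - w \<in> U)"

definition inner_product_on :: "'a::real_vector set \<Rightarrow> ('a \<Rightarrow> 'a \<Rightarrow> real) \<Rightarrow> bool" where
  "inner_product_on V b \<longleftrightarrow>
     (\<forall>x\<in>V. \<forall>y\<in>V. b x y = b y x) \<and>
     (\<forall>x\<in>V. \<forall>y\<in>V. \<forall>z\<in>V. b (x + y) z = b x z + b y z) \<and>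
     (\<forall>c. \<forall>x\<in>V. \<forall>y\<in>V. b (c *\<^sub>R x) y = c * b x y) \<and>
     (\<forall>x\<in>V. x \<noteq> 0 \<longrightarrow> b x x > 0)"

definition orthonormal_basis ::
  "'a::real_vector set \<Rightarrow> ('a \<Rightarrow> 'a \<Rightarrow> real) \<Rightarrow> 'a set \<Rightarrow> bool" where
  "orthonormal_basis V b E \<longleftrightarrow>
     finite E \<and> span E = V \<and> (\<forall>e\<in>E. \<forall>e'\<in>E. b e e' = (if e = e' then 1 else 0))"

definition lin_isometry_on ::
  "'a::real_vector set \<Rightarrow> ('a \<Rightarrow> 'a \<Rightarrow> real) \<Rightarrow> 'b::real_vector set \<Rightarrow> ('b \<Rightarrow> 'b \<Rightarrow> real) \<Rightarrow>
     ('a \<Rightarrow> 'b) \<Rightarrow> bool" where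
  "lin_isometry_on V b W c f \<longleftrightarrow>
     lin_map_on V W f \<and> bij_betw f V W \<and> (\<forall>x\<in>V. \<forall>y\<in>V. c (f x) (f y) = b x y)"

definition so_on :: "'a::real_vector set \<Rightarrow> ('a \<Rightarrow> 'a \<Rightarrow> real) \<Rightarrow> ('a \<Rightarrow> 'a) set" where
  "so_on V b = {f \<in> endos V. \<forall>x\<in>V. \<forall>y\<in>V. b (f x) y = - b x (f y)}"

text \<open>The vector of \<open>V\<close> that represents the linear form \<open>\<omega>\<close> on \<open>V\<close>.\<close>

definition sharp_on ::
  "'a set \<Rightarrow> ('a \<Rightarrow> 'a \<Rightarrow> real) \<Rightarrow> ('a \<Rightarrow> real) \<Rightarrow> 'a" where
  "sharp_on V b \<omega> = (THE v. v \<in> V \<and> (\<forall>z\<in>V. b v z = \<omega> z))"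

text \<open>Wedge product of a 2-form with a 1-form, normalised as
  \<open>(e\<^sub>1 \<and> e\<^sub>2) \<and> e\<^sub>3 (e\<^sub>1, e\<^sub>2, e\<^sub>3) = 1\<close>.\<close>

definition wedge21 ::
  "('a \<Rightarrow> 'a \<Rightarrow> real) \<Rightarrow> ('a \<Rightarrow> real) \<Rightarrow> 'a \<Rightarrow> 'a \<Rightarrow> 'a \<Rightarrow> real" where
  "wedge21 \<alpha> \<beta> x y z = \<alpha> x y * \<beta> z + \<alpha> y z * \<beta> x + \<alpha> z x * \<beta> y"


section \<open>Lie algebras\<close>

text \<open>A real finite-dimensional Lie algebra with underlying space \<open>L\<close>.\<close>

definition lie_algebra :: "'a::real_vector set \<Rightarrow> ('a \<Rightarrow> 'a \<Rightarrow> 'a) \<Rightarrow> bool" where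
  "lie_algebra L br \<longleftrightarrow>
     subspace L \<and> finite_dim L \<and>
     (\<forall>x\<in>L. lin_map_on L L (\<lambda>y. br x y)) \<and>
     (\<forall>y\<in>L. lin_map_on L L (\<lambda>x. br x y)) \<and>
     (\<forall>x\<in>L. br x x = 0) \<and>
     (\<forall>x\<in>L. \<forall>y\<in>L. \<forall>z\<in>L. br x (br y z) + br y (br z x) + br z (br x y) = 0)"

definition lie_subalgebra ::
  "'a::real_vector set \<Rightarrow> ('a \<Rightarrow> 'a \<Rightarrow> 'a) \<Rightarrow> 'a set \<Rightarrow> bool" where
  "lie_subalgebra L br S \<longleftrightarrow> subspace S \<and> S \<subseteq> L \<and> (\<forall>x\<in>S. \<forall>y\<in>S. br x y \<in> S)"

definition lie_ideal ::
  "'a::real_vector set \<Rightarrow> ('a \<Rightarrow> 'a \<Rightarrow> 'a) \<Rightarrow> 'a set \<Rightarrow> bool" where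
  "lie_ideal L br I \<longleftrightarrow> subspace I \<and> I \<subseteq> L \<and> (\<forall>x\<in>L. \<forall>y\<in>I. br x y \<in> I)"

definition lie_abelian :: "'a::real_vector set \<Rightarrow> ('a \<Rightarrow> 'a \<Rightarrow> 'a) \<Rightarrow> bool" where
  "lie_abelian S br \<longleftrightarrow> (\<forall>x\<in>S. \<forall>y\<in>S. br x y = 0)"

fun derived_series ::
  "'a::real_vector set \<Rightarrow> ('a \<Rightarrow> 'a \<Rightarrow> 'a) \<Rightarrow> nat \<Rightarrow> 'a set" where
  "derived_series L br 0 = L"
| "derived_series L br (Suc n) =
     span {br x y | x y. x \<in> derived_series L br n \<and> y \<in> derived_series L br n}"

definition lie_solvable :: "'a::real_vector set \<Rightarrow> ('a \<Rightarrow> 'a \<Rightarrow> 'a) \<Rightarrow> bool" where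
  "lie_solvable L br \<longleftrightarrow> (\<exists>n. derived_series L br n = {0})"

definition lie_semisimple :: "'a::real_vector set \<Rightarrow> ('a \<Rightarrow> 'a \<Rightarrow> 'a) \<Rightarrow> bool" where
  "lie_semisimple L br \<longleftrightarrow>
     lie_algebra L br \<and> (\<forall>I. lie_ideal L br I \<and> lie_solvable I br \<longrightarrow> I = {0})"

definition lie_iso ::
  "'a::real_vector set \<Rightarrow> ('a \<Rightarrow> 'a \<Rightarrow> 'a) \<Rightarrow> 'b::real_vector set \<Rightarrow> ('b \<Rightarrow> 'b \<Rightarrow> 'b) \<Rightarrow>
     ('a \<Rightarrow> 'b) \<Rightarrow> bool" where
  "lie_iso L br L' br' f \<longleftrightarrow>
     lin_map_on L L' f \<and> bij_betw f L L' \<and> (\<forall>x\<in>L. \<forall>y\<in>L. f (br x y) = br' (f x) (f y))"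

text \<open>\<open>L = S \<oplus> A\<close> as a direct sum of Lie algebras.\<close>

definition lie_direct_sum ::
  "'a::real_vector set \<Rightarrow> ('a \<Rightarrow> 'a \<Rightarrow> 'a) \<Rightarrow> 'a set \<Rightarrow> 'a set \<Rightarrow> bool" where
  "lie_direct_sum L br S A \<longleftrightarrow>
     direct_sum_of L S A \<and> lie_subalgebra L br S \<and> lie_subalgebra L br A \<and>
     (\<forall>x\<in>S. \<forall>y\<in>A. br x y = 0)"

text \<open>The greatest abelian ideal, that is, the one containing all abelian ideals.\<close>

definition maximal_abelian_ideal ::
  "'a::real_vector set \<Rightarrow> ('a \<Rightarrow> 'a \<Rightarrow> 'a) \<Rightarrow> 'a set \<Rightarrow> bool" where
  "maximal_abelian_ideal L br D \<longleftrightarrow>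
     lie_ideal L br D \<and> lie_abelian D br \<and>
     (\<forall>I. lie_ideal L br I \<and> lie_abelian I br \<longrightarrow> I \<subseteq> D)"

definition derivations :: "'a::real_vector set \<Rightarrow> ('a \<Rightarrow> 'a \<Rightarrow> 'a) \<Rightarrow> ('a \<Rightarrow> 'a) set" where
  "derivations L br = {f \<in> endos L. \<forall>x\<in>L. \<forall>y\<in>L. f (br x y) = br (f x) y + br x (f y)}"

text \<open>The map on endomorphisms induced by a bijection \<open>\<tau>\<close> from \<open>L\<close> onto \<open>L'\<close>:
  \<open>f \<mapsto> \<tau> \<circ> f \<circ> \<tau>\<^sup>-\<^sup>1\<close>.\<close>

definition induced_map ::
  "'a set \<Rightarrow> 'b set \<Rightarrow> ('a \<Rightarrow> 'b) \<Rightarrow> ('a \<Rightarrow> 'a) \<Rightarrow> 'b \<Rightarrow> 'b::zero" where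
  "induced_map L L' \<tau> f = zero_off L' (\<lambda>y. \<tau> (f (inv_into L \<tau> y)))"


section \<open>Naturally reductive decompositions\<close>

definition naturally_reductive ::
  "'a::real_vector set \<Rightarrow> ('a \<Rightarrow> 'a \<Rightarrow> 'a) \<Rightarrow> 'a set \<Rightarrow> 'a set \<Rightarrow> ('a \<Rightarrow> 'a \<Rightarrow> real) \<Rightarrow> bool" where
  "naturally_reductive G br H M g \<longleftrightarrow>
     lie_algebra G br \<and> lie_subalgebra G br H \<and> direct_sum_of G H M \<and>
     inner_product_on M g \<and>
     (\<forall>h\<in>H. \<forall>x\<in>M. br h x \<in> M) \<and>
     (\<forall>h\<in>H. \<forall>x\<in>M. \<forall>y\<in>M. g (br h x) y + g x (br h y) = 0) \<and>
     (\<forall>x\<in>M. \<forall>y\<in>M. \<forall>z\<in>M.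
        g (proj_along H M (br x y)) z = - g y (proj_along H M (br x z)))"

definition isotropy_ad :: "('a::real_vector \<Rightarrow> 'a \<Rightarrow> 'a) \<Rightarrow> 'a set \<Rightarrow> 'a \<Rightarrow> 'a \<Rightarrow> 'a" where
  "isotropy_ad br M h = zero_off M (br h)"

definition torsion_of ::
  "('a::real_vector \<Rightarrow> 'a \<Rightarrow> 'a) \<Rightarrow> 'a set \<Rightarrow> 'a set \<Rightarrow> 'a \<Rightarrow> 'a \<Rightarrow> 'a" where
  "torsion_of br H M x y = - proj_along H M (br x y)"

definition curvature_of ::
  "('a::real_vector \<Rightarrow> 'a \<Rightarrow> 'a) \<Rightarrow> 'a set \<Rightarrow> 'a set \<Rightarrow> 'a \<Rightarrow> 'a \<Rightarrow> 'a \<Rightarrow> 'a" where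
  "curvature_of br H M x y = - isotropy_ad br M (proj_along M H (br x y))"

text \<open>The image of a curvature-like map \<open>R\<close> viewed as a linear map on the second exterior power
  of \<open>V\<close>.\<close>

definition curvature_image ::
  "'a::real_vector set \<Rightarrow> ('a \<Rightarrow> 'a \<Rightarrow> 'a \<Rightarrow> 'a) \<Rightarrow> ('a \<Rightarrow> 'a) set" where
  "curvature_image V R = span {R x y | x y. x \<in> V \<and> y \<in> V}"

definition is_transvection_algebra ::
  "('a::real_vector \<Rightarrow> 'a \<Rightarrow> 'a) \<Rightarrow> 'a set \<Rightarrow> 'a set \<Rightarrow> bool" where
  "is_transvection_algebra br H M \<longleftrightarrow>
     inj_on (isotropy_ad br M) H \<and>
     curvature_image M (curvature_of br H M) = isotropy_ad br M ` H"

definition infinitesimal_model_iso ::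
  "'a::real_vector set \<Rightarrow> ('a \<Rightarrow> 'a \<Rightarrow> real) \<Rightarrow> ('a \<Rightarrow> 'a \<Rightarrow> 'a) \<Rightarrow> ('a \<Rightarrow> 'a \<Rightarrow> 'a \<Rightarrow> 'a) \<Rightarrow>
   'b::real_vector set \<Rightarrow> ('b \<Rightarrow> 'b \<Rightarrow> real) \<Rightarrow> ('b \<Rightarrow> 'b \<Rightarrow> 'b) \<Rightarrow> ('b \<Rightarrow> 'b \<Rightarrow> 'b \<Rightarrow> 'b) \<Rightarrow> bool" where
  "infinitesimal_model_iso V b T R W c T' R' \<longleftrightarrow>
     (\<exists>F. lin_isometry_on V b W c F \<and>
          (\<forall>x\<in>V. \<forall>y\<in>V. F (T x y) = T' (F x) (F y)) \<and>
          (\<forall>x\<in>V. \<forall>y\<in>V. \<forall>z\<in>V. F (R x y z) = R' (F x) (F y) (F z)))"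

text \<open>The decomposition \<open>G = H \<oplus> M0 \<oplus> A\<close>, \<open>M = M0 \<oplus> A\<close>, where \<open>H \<oplus> M0\<close> is semisimple or zero and
  \<open>A\<close>, the factor \<open>\<real>\<^sup>n\<close>, is a direct summand of the Lie algebra \<open>G\<close>.\<close>

definition semisimple_plus_flat ::
  "'a::real_vector set \<Rightarrow> ('a \<Rightarrow> 'a \<Rightarrow> 'a) \<Rightarrow> 'a set \<Rightarrow> 'a set \<Rightarrow> 'a set \<Rightarrow> 'a set \<Rightarrow> bool" where
  "semisimple_plus_flat G br H M M0 A \<longleftrightarrow>
     direct_sum_of M M0 A \<and>
     lie_direct_sum G br (sum_space H M0) A \<and> lie_abelian A br \<and>
     (lie_semisimple (sum_space H M0) br \<or> sum_space H M0 = {0})"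


section \<open>The Lie algebra of admissible derivations\<close>

text \<open>Elements of \<open>\<ss>(G)\<close> are derivations if \<open>G \<noteq> 0\<close>, and infinite matrices if \<open>G = 0\<close>. To have one
  type for both, an element is a pair \<open>(f, X)\<close>, with \<open>X = 0\<close> in the first case and \<open>f = 0\<close> in the
  second.\<close>

type_synonym 'a s_elem = "('a \<Rightarrow> 'a) \<times> (nat \<Rightarrow> nat \<Rightarrow> real)"

definition so_infinity :: "(nat \<Rightarrow> nat \<Rightarrow> real) set" where
  "so_infinity = {X. finite {(i, j). X i j \<noteq> 0} \<and> (\<forall>i j. X i j = - X j i)}"

definition matrix_mult ::
  "(nat \<Rightarrow> nat \<Rightarrow> real) \<Rightarrow> (nat \<Rightarrow> nat \<Rightarrow> real) \<Rightarrow> nat \<Rightarrow> nat \<Rightarrow> real" where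
  "matrix_mult X Y = (\<lambda>i j. \<Sum>l\<in>{l. X i l * Y l j \<noteq> 0}. X i l * Y l j)"

definition s_bracket :: "'a::real_vector s_elem \<Rightarrow> 'a s_elem \<Rightarrow> 'a s_elem" where
  "s_bracket k k' =
     (commutator (fst k) (fst k'),
      matrix_mult (snd k) (snd k') - matrix_mult (snd k') (snd k))"

definition s_algebra ::
  "'a::real_vector set \<Rightarrow> ('a \<Rightarrow> 'a \<Rightarrow> 'a) \<Rightarrow> 'a set \<Rightarrow> 'a set \<Rightarrow> ('a \<Rightarrow> 'a \<Rightarrow> real) \<Rightarrow>
     'a s_elem set" where
  "s_algebra G br H M g =
     (if G = {0} then {0} \<times> so_infinity
      else {f \<in> derivations G br.
              (\<forall>h\<in>H. f h = 0) \<and> f ` M \<subseteq> M \<and> zero_off M f \<in> so_on M g} \<times> {0})"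

text \<open>\<open>K\<close> is a finite-dimensional subalgebra of \<open>\<ss>(G)\<close> with an \<open>ad(K)\<close>-invariant inner product.\<close>

definition extension_data ::
  "'a::real_vector set \<Rightarrow> ('a \<Rightarrow> 'a \<Rightarrow> 'a) \<Rightarrow> 'a set \<Rightarrow> 'a set \<Rightarrow> ('a \<Rightarrow> 'a \<Rightarrow> real) \<Rightarrow>
     'a s_elem set \<Rightarrow> ('a s_elem \<Rightarrow> 'a s_elem \<Rightarrow> real) \<Rightarrow> bool" where
  "extension_data G br H M g K B \<longleftrightarrow>
     lie_subalgebra (s_algebra G br H M g) s_bracket K \<and> finite_dim K \<and>
     inner_product_on K B \<and>
     (\<forall>x\<in>K. \<forall>y\<in>K. \<forall>z\<in>K. B (s_bracket x y) z + B y (s_bracket x z) = 0)"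


section \<open>The extension of a naturally reductive decomposition\<close>

text \<open>The space \<open>\<nn> \<oplus> M\<close> is \<open>K \<times> M\<close>, the copy \<open>\<nn>\<close> of \<open>K\<close> being \<open>K \<times> {0}\<close>.\<close>

definition ext_inner ::
  "('a s_elem \<Rightarrow> 'a s_elem \<Rightarrow> real) \<Rightarrow> ('a \<Rightarrow> 'a \<Rightarrow> real) \<Rightarrow>
     'a s_elem \<times> 'a \<Rightarrow> 'a s_elem \<times> 'a \<Rightarrow> real" where
  "ext_inner B g u v = B (fst u) (fst v) + g (snd u) (snd v)"

definition rep_phi :: "'a::real_vector set \<Rightarrow> 'a s_elem \<Rightarrow> 'a \<Rightarrow> 'a" where
  "rep_phi M k = zero_off M (fst k)"

definition rep_phi_ext ::
  "'a::real_vector s_elem set \<Rightarrow> 'a set \<Rightarrow> 'a s_elem \<Rightarrow> 'a s_elem \<times> 'a \<Rightarrow> 'a s_elem \<times> 'a" where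
  "rep_phi_ext K M k = zero_off (K \<times> M) (\<lambda>u. (0, rep_phi M k (snd u)))"

definition rep_psi ::
  "'a::real_vector s_elem set \<Rightarrow> 'a set \<Rightarrow> 'a s_elem \<Rightarrow> 'a s_elem \<times> 'a \<Rightarrow> 'a s_elem \<times> 'a" where
  "rep_psi K M k = zero_off (K \<times> M) (\<lambda>u. (s_bracket k (fst u), rep_phi M k (snd u)))"

text \<open>In the next three definitions \<open>E\<close> is an orthonormal basis of \<open>K\<close>.\<close>

definition ext_torsion_form ::
  "('a::real_vector \<Rightarrow> 'a \<Rightarrow> 'a) \<Rightarrow> 'a set \<Rightarrow> 'a set \<Rightarrow> ('a \<Rightarrow> 'a \<Rightarrow> real) \<Rightarrow>
     'a s_elem set \<Rightarrow> ('a s_elem \<Rightarrow> 'a s_elem \<Rightarrow> real) \<Rightarrow> 'a s_elem set \<Rightarrow>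
     'a s_elem \<times> 'a \<Rightarrow> 'a s_elem \<times> 'a \<Rightarrow> 'a s_elem \<times> 'a \<Rightarrow> real" where
  "ext_torsion_form br H M g K B E u v w =
     g (torsion_of br H M (snd u) (snd v)) (snd w) +
     (\<Sum>e\<in>E. wedge21 (\<lambda>x y. ext_inner B g (rep_phi_ext K M e x) y)
                    (\<lambda>z. ext_inner B g (e, 0) z) u v w) +
     2 * B (s_bracket (fst u) (fst v)) (fst w)"

definition ext_torsion ::
  "('a::real_vector \<Rightarrow> 'a \<Rightarrow> 'a) \<Rightarrow> 'a set \<Rightarrow> 'a set \<Rightarrow> ('a \<Rightarrow> 'a \<Rightarrow> real) \<Rightarrow>
     'a s_elem set \<Rightarrow> ('a s_elem \<Rightarrow> 'a s_elem \<Rightarrow> real) \<Rightarrow> 'a s_elem set \<Rightarrow>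
     'a s_elem \<times> 'a \<Rightarrow> 'a s_elem \<times> 'a \<Rightarrow> 'a s_elem \<times> 'a" where
  "ext_torsion br H M g K B E u v =
     sharp_on (K \<times> M) (ext_inner B g) (ext_torsion_form br H M g K B E u v)"

definition ext_curvature ::
  "('a::real_vector \<Rightarrow> 'a \<Rightarrow> 'a) \<Rightarrow> 'a set \<Rightarrow> 'a set \<Rightarrow> ('a \<Rightarrow> 'a \<Rightarrow> real) \<Rightarrow>
     'a s_elem set \<Rightarrow> ('a s_elem \<Rightarrow> 'a s_elem \<Rightarrow> real) \<Rightarrow> 'a s_elem set \<Rightarrow>
     'a s_elem \<times> 'a \<Rightarrow> 'a s_elem \<times> 'a \<Rightarrow> 'a s_elem \<times> 'a \<Rightarrow> 'a s_elem \<times> 'a" where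
  "ext_curvature br H M g K B E u v =
     zero_off (K \<times> M) (\<lambda>w. (0, curvature_of br H M (snd u) (snd v) (snd w))) +
     (\<Sum>e\<in>E. ext_inner B g (rep_psi K M e u) v *\<^sub>R rep_psi K M e)"

text \<open>The Lie algebra \<open>im(R) \<oplus> V\<close> built from an infinitesimal model \<open>(T, R)\<close> on \<open>V\<close>; the pair
  \<open>(A, x)\<close> stands for \<open>A + x\<close>.\<close>

definition model_algebra ::
  "'v::real_vector set \<Rightarrow> ('v \<Rightarrow> 'v \<Rightarrow> 'v \<Rightarrow> 'v) \<Rightarrow> (('v \<Rightarrow> 'v) \<times> 'v) set" where
  "model_algebra V R = curvature_image V R \<times> V"

definition model_bracket ::
  "('v::real_vector \<Rightarrow> 'v \<Rightarrow> 'v) \<Rightarrow> ('v \<Rightarrow> 'v \<Rightarrow> 'v \<Rightarrow> 'v) \<Rightarrow>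
     ('v \<Rightarrow> 'v) \<times> 'v \<Rightarrow> ('v \<Rightarrow> 'v) \<times> 'v \<Rightarrow> ('v \<Rightarrow> 'v) \<times> 'v" where
  "model_bracket T R p q =
     (commutator (fst p) (fst q) - R (snd p) (snd q),
      fst p (snd q) - fst q (snd p) - T (snd p) (snd q))"

definition canonical_base_space ::
  "('a::real_vector \<Rightarrow> 'a \<Rightarrow> 'a) \<Rightarrow> 'a set \<Rightarrow> 'a set \<Rightarrow> ('a \<Rightarrow> 'a \<Rightarrow> real) \<Rightarrow>
     'a s_elem set \<Rightarrow> ('a s_elem \<Rightarrow> 'a s_elem \<Rightarrow> real) \<Rightarrow> 'a s_elem set \<Rightarrow> bool" where
  "canonical_base_space br H M g K B E \<longleftrightarrow>
     (let T = ext_torsion br H M g K B E; R = ext_curvature br H M g K B E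
      in \<exists>D. maximal_abelian_ideal (model_algebra (K \<times> M) R) (model_bracket T R) D \<and>
             snd ` D = K \<times> {0})"

end

theory Submission
  imports Defs
begin

text \<open>
  Let \<open>F\<close> be an isometry \<open>\<nn>\<^sub>1 \<oplus> \<mm>\<^sub>1 \<rightarrow> \<nn>\<^sub>2 \<oplus> \<mm>\<^sub>2\<close> that carries the torsion and curvature of one extension
  to those of the other. The transvection algebra of an extension is built from its infinitesimal
  model alone, so \<open>F\<close> induces an isomorphism \<open>(A, x) \<mapsto> (F A F\<^sup>-\<^sup>1, F x)\<close> of transvection algebras,
  and this isomorphism respects maximal abelian ideals
  (\<open>model_isomorphism.maximal_abelian_ideal_projection\<close>). Both base spaces are canonical, so these
  ideals project onto \<open>\<nn>\<^sub>1\<close> and \<open>\<nn>\<^sub>2\<close>; hence \<open>F(\<nn>\<^sub>1) = \<nn>\<^sub>2\<close>, and by orthogonality \<open>F(\<mm>\<^sub>1) = \<mm>\<^sub>2\<close>. So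
  \<open>F = \<theta> \<oplus> S\<close> with isometries \<open>\<theta> : \<kk>\<^sub>1 \<rightarrow> \<kk>\<^sub>2\<close> and \<open>S : \<mm>\<^sub>1 \<rightarrow> \<mm>\<^sub>2\<close>.

  The rest is read off from the components of the torsion and the curvature. In terms of
  the splitting, the torsion is
  \<open>T(k + x, k' + x') = (2[k, k'] + P(x, x')) + (T\<^sub>0(x, x') + \<phi>(k)x' - \<phi>(k')x)\<close>, where \<open>P(x, x') \<in> \<nn>\<close> is
  determined by \<open>B(P(x, x'), k) = g(\<phi>(k)x, x')\<close> (\<open>ext_torsion_eq\<close>). Comparing components, \<open>\<theta>\<close> is a
  Lie algebra isomorphism, \<open>S\<close> carries \<open>T\<^sub>0\<close> to \<open>T\<^sub>0\<close>, \<open>S \<circ> \<phi>(k) = \<phi>(\<theta> k) \<circ> S\<close>, and \<open>\<theta> P(x, y) = P(S x, S y)\<close>.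
  On \<open>\<mm>\<close> the curvature acts by \<open>R\<^sub>0(x, y) + \<phi>(P(x, y))\<close> (\<open>ext_curvature_M\<close>), so \<open>S\<close> also carries \<open>R\<^sub>0\<close> to \<open>R\<^sub>0\<close>.

  A transvection algebra is determined by its infinitesimal model, because \<open>\<hh>\<close> is the span of the
  curvature operators. So \<open>S\<close> extends to an isomorphism \<open>\<tau> : \<gg>\<^sub>1 \<rightarrow> \<gg>\<^sub>2\<close>
  with \<open>\<tau>(\<hh>\<^sub>1) = \<hh>\<^sub>2\<close> (\<open>lie_iso_of_model_isometry\<close>). An element of \<open>\<ss>(\<gg>)\<close> kills \<open>\<hh>\<close> and is therefore
  determined by its action on \<open>\<mm>\<close>, so the relation \<open>S \<circ> \<phi>(k) = \<phi>(\<theta> k) \<circ> S\<close> says that \<open>\<tau>\<^sub>* = \<theta>\<close>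
  on \<open>\<kk>\<^sub>1\<close>.
\<close>

section \<open>Linear maps, projections and inner products on subspaces\<close>

lemma lin_map_onD:
  assumes "lin_map_on V W f"
  shows "x \<in> V \<Longrightarrow> f x \<in> W"
    and "x \<in> V \<Longrightarrow> y \<in> V \<Longrightarrow> f (x + y) = f x + f y"
    and "x \<in> V \<Longrightarrow> f (c *\<^sub>R x) = c *\<^sub>R f x"
  using assms unfolding lin_map_on_def by blast+

lemma lin_map_on_zero_minus:
  assumes "lin_map_on V W f" and V: "subspace V"
  shows "f 0 = 0" and "x \<in> V \<Longrightarrow> f (- x) = - f x"
    and "x \<in> V \<Longrightarrow> y \<in> V \<Longrightarrow> f (x - y) = f x - f y"
proof -
  note f = lin_map_onD[OF assms(1)]
  have neg: "f (- x) = - f x" if "x \<in> V" for x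
    using f(3)[OF that, of "-1"] by simp
  show "f 0 = 0"
    using f(3)[OF subspace_0[OF V], of 0] by simp
  show "x \<in> V \<Longrightarrow> f (- x) = - f x" by (rule neg)
  show "x \<in> V \<Longrightarrow> y \<in> V \<Longrightarrow> f (x - y) = f x - f y"
    using f(2)[of x "- y"] neg[of y] subspace_neg[OF V, of y] by simp
qed

lemma lin_map_on_span_image:
  assumes f: "lin_map_on V W f" and V: "subspace V" and S: "S \<subseteq> V"
  shows "f ` span S = span (f ` S)"
proof
  have SV: "span S \<subseteq> V" using span_minimal[OF S V] .
  show "f ` span S \<subseteq> span (f ` S)"
  proof
    fix y assume "y \<in> f ` span S"
    then obtain x where x: "x \<in> span S" "y = f x" by blast
    have "f x \<in> span (f ` S) \<and> x \<in> V" using x(1)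
    proof (induction rule: span_induct_alt)
      case base
      then show ?case using lin_map_on_zero_minus(1)[OF f V] span_0 subspace_0[OF V] by simp
    next
      case (step c x y)
      have "x \<in> V" using step S by auto
      then have "f (c *\<^sub>R x + y) = c *\<^sub>R f x + f y" "c *\<^sub>R x + y \<in> V"
        using step lin_map_onD[OF f] V by (simp_all add: subspace_scale subspace_add)
      then show ?case using step by (simp add: span_add span_scale span_base)
    qed
    then show "y \<in> span (f ` S)" using x(2) by simp
  qed
  show "span (f ` S) \<subseteq> f ` span S"
  proof (rule span_minimal)
    show "f ` S \<subseteq> f ` span S" using span_superset by blast
    show "subspace (f ` span S)"
    proof (rule subspaceI)
      show "0 \<in> f ` span S"
        using lin_map_on_zero_minus(1)[OF f V] span_0[of S] by (metis imageI)
    next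
      fix x y assume "x \<in> f ` span S" "y \<in> f ` span S"
      then obtain u v where "u \<in> span S" "v \<in> span S" "x = f u" "y = f v" by blast
      then show "x + y \<in> f ` span S"
        using lin_map_onD(2)[OF f, of u v] SV span_add[of u S v]
        by (metis imageI subsetD)
    next
      fix c x assume "x \<in> f ` span S"
      then obtain u where "u \<in> span S" "x = f u" by blast
      then show "c *\<^sub>R x \<in> f ` span S"
        using lin_map_onD(3)[OF f, of u c] SV span_scale[of u S c]
        by (metis imageI subsetD)
    qed
  qed
qed

lemma lin_map_on_inv_into:
  assumes f: "lin_map_on V W f" and V: "subspace V" and bij: "bij_betw f V W"
  shows "lin_map_on W V (inv_into V f)"
proof -
  have inj: "inj_on f V" and W: "W = f ` V" using bij by (auto simp: bij_betw_def)
  have "inv_into V f (f x + f y) = x + y" if "x \<in> V" "y \<in> V" for x y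
    using that lin_map_onD(2)[OF f, of x y] inv_into_f_f[OF inj, of "x + y"]
    by (simp add: subspace_add[OF V])
  moreover have "inv_into V f (c *\<^sub>R f x) = c *\<^sub>R x" if "x \<in> V" for c x
    using that lin_map_onD(3)[OF f, of x c] inv_into_f_f[OF inj, of "c *\<^sub>R x"]
    by (simp add: subspace_scale[OF V])
  ultimately show ?thesis
    unfolding lin_map_on_def W by (auto simp: inv_into_f_f[OF inj])
qed

lemma lin_isometry_on_cong:
  assumes f: "lin_isometry_on V b W c f" and V: "subspace V" and eq: "\<And>x. x \<in> V \<Longrightarrow> h x = f x"
  shows "lin_isometry_on V b W c h"
proof -
  have "bij_betw h V W" using f eq bij_betw_cong[of V h f W] by (simp add: lin_isometry_on_def)
  then show ?thesis
    using f eq V unfolding lin_isometry_on_def lin_map_on_def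
    by (auto simp: subspace_add subspace_scale)
qed

lemma direct_sum_of_commute: "direct_sum_of V U W \<Longrightarrow> direct_sum_of V W U"
  unfolding direct_sum_of_def sum_space_def
  by (auto simp: Int_commute) (metis add.commute)+

lemma direct_sum_of_subset:
  assumes "direct_sum_of V U W" shows "U \<subseteq> V" "W \<subseteq> V"
proof -
  have U: "subspace U" and W: "subspace W" and V: "V = {u + w | u w. u \<in> U \<and> w \<in> W}"
    using assms by (auto simp: direct_sum_of_def sum_space_def)
  show "U \<subseteq> V"
  proof
    fix u assume "u \<in> U"
    then have "u = u + 0 \<and> u \<in> U \<and> 0 \<in> W" using subspace_0[OF W] by simp
    then show "u \<in> V" unfolding V by blast
  qed
  show "W \<subseteq> V"
  proof
    fix w assume "w \<in> W"
    then have "w = 0 + w \<and> 0 \<in> U \<and> w \<in> W" using subspace_0[OF U] by simp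
    then show "w \<in> V" unfolding V by blast
  qed
qed

lemma proj_along_eqI:
  assumes "direct_sum_of V U W" and w: "w \<in> W" "x - w \<in> U"
  shows "proj_along U W x = w"
  unfolding proj_along_def
proof (rule the_equality)
  show "w \<in> W \<and> x - w \<in> U" using w by simp
  fix v assume v: "v \<in> W \<and> x - v \<in> U"
  have U: "subspace U" and W: "subspace W" and 0: "U \<inter> W = {0}"
    using assms(1) by (auto simp: direct_sum_of_def)
  have "v - w \<in> W" using v w subspace_diff[OF W] by blast
  moreover have "(x - w) - (x - v) = v - w" by (simp add: algebra_simps)
  then have "v - w \<in> U" using v w subspace_diff[OF U] by metis
  ultimately have "v - w \<in> U \<inter> W" by blast
  then show "v = w" unfolding 0 by simp
qed

lemma proj_along_sum:
  "direct_sum_of V U W \<Longrightarrow> u \<in> U \<Longrightarrow> w \<in> W \<Longrightarrow> proj_along U W (u + w) = w"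
  by (rule proj_along_eqI) auto

lemma proj_along_in:
  assumes "direct_sum_of V U W" and "x \<in> V"
  shows "proj_along U W x \<in> W" and "proj_along W U x \<in> U"
    and "proj_along W U x + proj_along U W x = x"
proof -
  obtain u w where uw: "x = u + w" "u \<in> U" "w \<in> W"
    using assms by (auto simp: direct_sum_of_def sum_space_def)
  have "proj_along U W x = w" using proj_along_sum[OF assms(1) uw(2,3)] uw(1) by simp
  moreover have "proj_along W U x = u"
    using proj_along_sum[OF direct_sum_of_commute[OF assms(1)] uw(3,2)] uw(1)
    by (simp add: add.commute)
  ultimately show "proj_along U W x \<in> W" "proj_along W U x \<in> U"
    "proj_along W U x + proj_along U W x = x" using uw by auto
qed

lemma inner_product_onD:
  assumes "inner_product_on V b" and V: "subspace V"
  shows "x \<in> V \<Longrightarrow> y \<in> V \<Longrightarrow> b x y = b y x"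
    and "x \<in> V \<Longrightarrow> y \<in> V \<Longrightarrow> z \<in> V \<Longrightarrow> b (x + y) z = b x z + b y z"
    and "x \<in> V \<Longrightarrow> y \<in> V \<Longrightarrow> b (c *\<^sub>R x) y = c * b x y"
    and "x \<in> V \<Longrightarrow> b x x = 0 \<longleftrightarrow> x = 0"
    and "y \<in> V \<Longrightarrow> b 0 y = 0" and "y \<in> V \<Longrightarrow> b y 0 = 0"
    and "x \<in> V \<Longrightarrow> y \<in> V \<Longrightarrow> z \<in> V \<Longrightarrow> b (x - y) z = b x z - b y z"
proof -
  have sym: "x \<in> V \<Longrightarrow> y \<in> V \<Longrightarrow> b x y = b y x"
    and add: "x \<in> V \<Longrightarrow> y \<in> V \<Longrightarrow> z \<in> V \<Longrightarrow> b (x + y) z = b x z + b y z"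
    and sc: "x \<in> V \<Longrightarrow> y \<in> V \<Longrightarrow> b (c *\<^sub>R x) y = c * b x y"
    and pos: "x \<in> V \<Longrightarrow> x \<noteq> 0 \<Longrightarrow> b x x > 0" for x y z c
    using assms(1) by (auto simp: inner_product_on_def)
  have z: "b 0 y = 0" if "y \<in> V" for y
    using sc[OF subspace_0[OF V] that, of 0] by simp
  show "x \<in> V \<Longrightarrow> y \<in> V \<Longrightarrow> b x y = b y x" by (rule sym)
  show "x \<in> V \<Longrightarrow> y \<in> V \<Longrightarrow> z \<in> V \<Longrightarrow> b (x + y) z = b x z + b y z" by (rule add)
  show "x \<in> V \<Longrightarrow> y \<in> V \<Longrightarrow> b (c *\<^sub>R x) y = c * b x y" by (rule sc)
  show "x \<in> V \<Longrightarrow> b x x = 0 \<longleftrightarrow> x = 0" using pos[of x] z[of x] by fastforce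
  show "y \<in> V \<Longrightarrow> b 0 y = 0" by (rule z)
  show "y \<in> V \<Longrightarrow> b y 0 = 0" using z[of y] sym[of y 0] subspace_0[OF V] by simp
  show "x \<in> V \<Longrightarrow> y \<in> V \<Longrightarrow> z \<in> V \<Longrightarrow> b (x - y) z = b x z - b y z"
    using add[of x "- y" z] sc[of y z "-1"] subspace_neg[OF V, of y] by simp
qed

lemma inner_product_on_sum:
  assumes b: "inner_product_on V b" and V: "subspace V" and E: "E \<subseteq> V" and y: "y \<in> V"
  shows "b (\<Sum>e\<in>E. c e *\<^sub>R e) y = (\<Sum>e\<in>E. c e * b e y)"
  using E
proof (induction E rule: infinite_finite_induct)
  case (insert e E)
  then have "(\<Sum>e\<in>E. c e *\<^sub>R e) \<in> V"
    by (intro subspace_sum[OF V] subspace_scale[OF V]) auto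
  then show ?case
    using insert inner_product_onD(2,3)[OF b V] y subspace_scale[OF V] by simp
qed (use inner_product_onD(5)[OF b V y] in auto)

lemma sharp_on_eqI:
  assumes b: "inner_product_on V b" and V: "subspace V"
    and v: "v \<in> V" "\<And>z. z \<in> V \<Longrightarrow> b v z = \<omega> z"
  shows "sharp_on V b \<omega> = v"
  unfolding sharp_on_def
proof (rule the_equality)
  show "v \<in> V \<and> (\<forall>z\<in>V. b v z = \<omega> z)" using v by blast
  fix w assume w: "w \<in> V \<and> (\<forall>z\<in>V. b w z = \<omega> z)"
  have d: "w - v \<in> V" using w v subspace_diff[OF V] by blast
  then have "b (w - v) (w - v) = 0"
    using inner_product_onD(7)[OF b V, of w v "w - v"] w v by simp
  then show "w = v" using inner_product_onD(4)[OF b V d] by simp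
qed

lemma orthonormal_basis_expansion:
  assumes E: "orthonormal_basis V b E" and b: "inner_product_on V b" and V: "subspace V"
    and x: "x \<in> V"
  shows "x = (\<Sum>e\<in>E. b e x *\<^sub>R e)"
proof -
  have fin: "finite E" and sp: "span E = V"
    and on: "e \<in> E \<Longrightarrow> e' \<in> E \<Longrightarrow> b e e' = (if e = e' then 1 else 0)" for e e'
    using E by (auto simp: orthonormal_basis_def)
  have EV: "E \<subseteq> V" using span_superset[of E] sp by blast
  obtain c where c: "x = (\<Sum>e\<in>E. c e *\<^sub>R e)"
    using x sp span_finite[OF fin] by auto
  have "b e x = c e" if e: "e \<in> E" for e
  proof -
    have "b e x = b x e" using inner_product_onD(1)[OF b V] x e EV by blast
    also have "\<dots> = (\<Sum>e'\<in>E. c e' * b e' e)"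
      unfolding c using inner_product_on_sum[OF b V EV] e EV by blast
    also have "\<dots> = (\<Sum>e'\<in>E. if e' = e then c e' else 0)"
      by (rule sum.cong) (auto simp: on e)
    finally show ?thesis using e fin by simp
  qed
  then show ?thesis using c by simp
qed

lemma subspace_Times: "subspace U \<Longrightarrow> subspace W \<Longrightarrow> subspace (U \<times> W)"
  unfolding subspace_def by (auto simp: zero_prod_def)

lemma inner_product_on_ext_inner:
  assumes B: "inner_product_on K B" and g: "inner_product_on M g"
    and K: "subspace K" and M: "subspace M"
  shows "inner_product_on (K \<times> M) (ext_inner B g)"
proof -
  note b = inner_product_onD[OF B K] and c = inner_product_onD[OF g M]
  have "B k k \<ge> 0" if "k \<in> K" for k
    using B that b(4)[OF that] by (cases "k = 0") (auto simp: inner_product_on_def less_imp_le)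
  moreover have "g x x \<ge> 0" if "x \<in> M" for x
    using g that c(4)[OF that] by (cases "x = 0") (auto simp: inner_product_on_def less_imp_le)
  ultimately have "B k k + g x x > 0" if "k \<in> K" "x \<in> M" "(k, x) \<noteq> 0" for k x
    using that b(4)[of k] c(4)[of x] by (smt (verit) zero_prod_def)
  then show ?thesis
    unfolding inner_product_on_def ext_inner_def
    using b(1-3) c(1-3) by (auto simp: distrib_left zero_prod_def)
qed


section \<open>Conjugation of endomorphisms by a bijection\<close>

text \<open>The space in which curvature operators live. Vanishing at \<open>0\<close> makes a composite \<open>f \<circ> h\<close> vanish
  wherever \<open>h\<close> does, so commutators are again zero off \<open>V\<close>.\<close>

definition selfmaps :: "'a::real_vector set \<Rightarrow> ('a \<Rightarrow> 'a) set" where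
  "selfmaps V = {f. f 0 = 0 \<and> (\<forall>x\<in>V. f x \<in> V) \<and> (\<forall>x. x \<notin> V \<longrightarrow> f x = 0)}"

lemma subspace_selfmaps:
  assumes "subspace V" shows "subspace (selfmaps V)"
  using assms unfolding subspace_def selfmaps_def
  by (auto simp: scaleR_fun_def)

lemma induced_map_apply:
  "bij_betw F V W \<Longrightarrow> x \<in> V \<Longrightarrow> induced_map V W F f (F x) = F (f x)"
  unfolding induced_map_def zero_off_def by (auto simp: bij_betw_def)

lemma induced_map_off: "y \<notin> W \<Longrightarrow> induced_map V W F f y = 0"
  unfolding induced_map_def zero_off_def by simp

lemma bij_betw_preimage: "bij_betw F V W \<Longrightarrow> y \<in> W \<Longrightarrow> \<exists>x\<in>V. y = F x"
  unfolding bij_betw_def by blast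

lemma induced_map_eqI:
  assumes "bij_betw F V W" and "\<And>y. y \<notin> W \<Longrightarrow> f' y = 0"
    and "\<And>x. x \<in> V \<Longrightarrow> f' (F x) = F (f x)"
  shows "induced_map V W F f = f'"
proof
  fix y
  show "induced_map V W F f y = f' y"
  proof (cases "y \<in> W")
    case True
    then obtain x where "x \<in> V" "y = F x" using bij_betw_preimage[OF assms(1)] by blast
    then show ?thesis using assms induced_map_apply by metis
  qed (simp add: induced_map_off assms(2))
qed

lemma lin_map_on_induced_map:
  assumes F: "lin_map_on V W F" and V: "subspace V" and bij: "bij_betw F V W"
  shows "lin_map_on (selfmaps V) (selfmaps W) (induced_map V W F)"
proof -
  note ap = induced_map_apply[OF bij]
  have "induced_map V W F f \<in> selfmaps W" if "f \<in> selfmaps V" for f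
  proof -
    have "induced_map V W F f y \<in> W" if "y \<in> W" for y
    proof -
      obtain x where "x \<in> V" "y = F x" using bij_betw_preimage[OF bij \<open>y \<in> W\<close>] by blast
      then show ?thesis
        using ap[of x f] lin_map_onD(1)[OF F, of "f x"] \<open>f \<in> selfmaps V\<close> by (simp add: selfmaps_def)
    qed
    moreover have "induced_map V W F f 0 = 0"
      using ap[OF subspace_0[OF V], of f] lin_map_on_zero_minus(1)[OF F V] that
      by (simp add: selfmaps_def)
    ultimately show ?thesis by (simp add: selfmaps_def induced_map_off)
  qed
  moreover have "induced_map V W F (f + h) = induced_map V W F f + induced_map V W F h"
    if "f \<in> selfmaps V" "h \<in> selfmaps V" for f h
    by (rule induced_map_eqI[OF bij])
      (use that lin_map_onD(2)[OF F] in \<open>auto simp: induced_map_off ap selfmaps_def\<close>)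
  moreover have "induced_map V W F (c *\<^sub>R f) = c *\<^sub>R induced_map V W F f"
    if "f \<in> selfmaps V" for c f
    by (rule induced_map_eqI[OF bij])
      (use that lin_map_onD(3)[OF F] in \<open>auto simp: induced_map_off ap selfmaps_def scaleR_fun_def\<close>)
  ultimately show ?thesis unfolding lin_map_on_def by blast
qed

text \<open>Conjugation by \<open>F\<close> is linear on operators and matches the generators \<open>R(x, y)\<close> and
  \<open>R'(F x, F y)\<close> of the two spans.\<close>

lemma induced_map_curvature_image:
  assumes F: "lin_map_on V W F" and V: "subspace V" and bij: "bij_betw F V W"
    and R: "\<And>x y. x \<in> V \<Longrightarrow> y \<in> V \<Longrightarrow> R x y \<in> selfmaps V"
    and R': "\<And>x y. x \<in> W \<Longrightarrow> y \<in> W \<Longrightarrow> R' x y \<in> selfmaps W"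
    and FR: "\<And>x y z. x \<in> V \<Longrightarrow> y \<in> V \<Longrightarrow> z \<in> V \<Longrightarrow> F (R x y z) = R' (F x) (F y) (F z)"
  shows "induced_map V W F ` curvature_image V R = curvature_image W R'"
proof -
  have W: "W = F ` V" using bij by (simp add: bij_betw_def)
  have eq: "induced_map V W F (R x y) = R' (F x) (F y)" if "x \<in> V" "y \<in> V" for x y
    by (rule induced_map_eqI[OF bij])
      (use that R'[of "F x" "F y"] FR W in \<open>auto simp: selfmaps_def\<close>)
  have "induced_map V W F ` {R x y | x y. x \<in> V \<and> y \<in> V}
      = {R' x y | x y. x \<in> W \<and> y \<in> W}"
  proof (intro set_eqI iffI)
    fix f assume "f \<in> induced_map V W F ` {R x y | x y. x \<in> V \<and> y \<in> V}"
    then show "f \<in> {R' x y | x y. x \<in> W \<and> y \<in> W}" using eq W by blast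
  next
    fix f assume "f \<in> {R' x y | x y. x \<in> W \<and> y \<in> W}"
    then obtain x y where "x \<in> V" "y \<in> V" "f = R' (F x) (F y)" using W by blast
    then have "f = induced_map V W F (R x y)" using eq by simp
    then show "f \<in> induced_map V W F ` {R x y | x y. x \<in> V \<and> y \<in> V}"
      using \<open>x \<in> V\<close> \<open>y \<in> V\<close> by blast
  qed
  moreover have "{R x y | x y. x \<in> V \<and> y \<in> V} \<subseteq> selfmaps V" using R by blast
  from lin_map_on_span_image[OF lin_map_on_induced_map[OF F V bij] subspace_selfmaps[OF V] this]
  have "induced_map V W F ` span {R x y | x y. x \<in> V \<and> y \<in> V}
    = span (induced_map V W F ` {R x y | x y. x \<in> V \<and> y \<in> V})" .
  ultimately show ?thesis by (simp only: curvature_image_def)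
qed


section \<open>Isomorphic models have isomorphic transvection algebras\<close>

locale model_isomorphism =
  fixes V :: "'a::real_vector set" and T R
    and W :: "'b::real_vector set" and T' R' and F :: "'a \<Rightarrow> 'b"
  assumes V: "subspace V" and W: "subspace W"
    and F: "lin_map_on V W F" and bij: "bij_betw F V W"
    and T: "x \<in> V \<Longrightarrow> y \<in> V \<Longrightarrow> T x y \<in> V"
    and T': "x' \<in> W \<Longrightarrow> y' \<in> W \<Longrightarrow> T' x' y' \<in> W"
    and R: "x \<in> V \<Longrightarrow> y \<in> V \<Longrightarrow> R x y \<in> selfmaps V"
    and R': "x' \<in> W \<Longrightarrow> y' \<in> W \<Longrightarrow> R' x' y' \<in> selfmaps W"
    and FT: "x \<in> V \<Longrightarrow> y \<in> V \<Longrightarrow> F (T x y) = T' (F x) (F y)"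
    and FR: "x \<in> V \<Longrightarrow> y \<in> V \<Longrightarrow> z \<in> V \<Longrightarrow> F (R x y z) = R' (F x) (F y) (F z)"
begin

lemma inverse: "model_isomorphism W T' R' V T R (inv_into V F)"
proof -
  let ?I = "inv_into V F"
  have I: "?I (F x) = x" if "x \<in> V" for x using bij that by (simp add: bij_betw_def)
  note FI = bij_betw_preimage[OF bij]
  show ?thesis
  proof
    show "?I (T' x y) = T (?I x) (?I y)" if xy: "x \<in> W" "y \<in> W" for x y
    proof -
      obtain u v where uv: "u \<in> V" "v \<in> V" "x = F u" "y = F v" using xy FI by metis
      then show ?thesis using FT[of u v] I[of "T u v"] T[of u v] by (simp add: I)
    qed
    show "?I (R' x y z) = R (?I x) (?I y) (?I z)" if xyz: "x \<in> W" "y \<in> W" "z \<in> W" for x y z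
    proof -
      obtain u v w where uv: "u \<in> V" "v \<in> V" "w \<in> V" "x = F u" "y = F v" "z = F w"
        using xyz FI by metis
      have "R u v w \<in> V" using R[OF uv(1,2)] uv(3) by (simp add: selfmaps_def)
      then show ?thesis using uv FR[of u v w] I[of "R u v w"] by (simp add: I)
    qed
  qed (use V W T T' R R' lin_map_on_inv_into[OF F V bij] bij_betw_inv_into[OF bij] in auto)
qed

definition algebra_map :: "('a \<Rightarrow> 'a) \<times> 'a \<Rightarrow> ('b \<Rightarrow> 'b) \<times> 'b" where
  "algebra_map p = (induced_map V W F (fst p), F (snd p))"

lemma curvature_image_selfmaps: "curvature_image V R \<subseteq> selfmaps V"
  unfolding curvature_image_def
  by (rule span_minimal[OF _ subspace_selfmaps[OF V]]) (use R in auto)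

lemma model_algebra_subset: "model_algebra V R \<subseteq> selfmaps V \<times> V"
  unfolding model_algebra_def using curvature_image_selfmaps by blast

lemma algebra_map_image: "algebra_map ` model_algebra V R = model_algebra W R'"
proof -
  have "induced_map V W F ` curvature_image V R = curvature_image W R'"
    by (rule induced_map_curvature_image[OF F V bij]) (use R R' FR in auto)
  moreover have "F ` V = W" using bij by (simp add: bij_betw_def)
  moreover have "algebra_map = map_prod (induced_map V W F) F"
    by (simp add: fun_eq_iff algebra_map_def)
  ultimately show ?thesis
    unfolding model_algebra_def
    by (simp add: map_prod_surj_on)
qed

lemma algebra_map_linear: "lin_map_on (selfmaps V \<times> V) UNIV algebra_map"
  using lin_map_onD(2,3)[OF F] lin_map_onD(2,3)[OF lin_map_on_induced_map[OF F V bij]]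
  unfolding lin_map_on_def by (auto simp: algebra_map_def)

text \<open>The bracket is built from commutators, evaluation of operators, \<open>T\<close> and \<open>R\<close>, all of which are
  natural under \<open>F\<close>.\<close>

lemma algebra_map_bracket:
  assumes p: "p \<in> model_algebra V R" and q: "q \<in> model_algebra V R"
  shows "algebra_map (model_bracket T R p q)
    = model_bracket T' R' (algebra_map p) (algebra_map q)"
proof -
  obtain a x where ax: "p = (a, x)" "a \<in> selfmaps V" "x \<in> V"
    using p model_algebra_subset by (cases p) auto
  obtain c y where cy: "q = (c, y)" "c \<in> selfmaps V" "y \<in> V"
    using q model_algebra_subset by (cases q) auto
  note ap = induced_map_apply[OF bij]
  note Fdiff = lin_map_on_zero_minus(3)[OF F V]
  have mem: "a z \<in> V" "c z \<in> V" "R x y z \<in> V" if "z \<in> V" for z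
    using ax cy R[of x y] that by (auto simp: selfmaps_def)
  let ?a = "induced_map V W F a" and ?c = "induced_map V W F c"
  have "induced_map V W F (commutator a c - R x y) = commutator ?a ?c - R' (F x) (F y)"
  proof (rule induced_map_eqI[OF bij])
    fix z assume "z \<in> V"
    then show "(commutator ?a ?c - R' (F x) (F y)) (F z) = F ((commutator a c - R x y) z)"
      using mem ax cy
      by (simp add: commutator_def ap FR Fdiff subspace_diff[OF V])
  next
    fix z :: 'b assume z: "z \<notin> W"
    have sm: "?a \<in> selfmaps W" "?c \<in> selfmaps W"
      using lin_map_onD(1)[OF lin_map_on_induced_map[OF F V bij]] ax cy by auto
    then show "(commutator ?a ?c - R' (F x) (F y)) z = 0"
      using z sm R'[of "F x" "F y"] ax cy lin_map_onD(1)[OF F]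
      by (simp add: commutator_def induced_map_off selfmaps_def)
  qed
  moreover have "F (a y - c x - T x y) = ?a (F y) - ?c (F x) - T' (F x) (F y)"
    using mem ax cy T by (simp add: ap FT Fdiff subspace_diff[OF V])
  ultimately show ?thesis
    by (simp add: algebra_map_def model_bracket_def ax(1) cy(1))
qed

lemma algebra_map_abelian_ideal:
  assumes D: "lie_ideal (model_algebra V R) (model_bracket T R) D"
    and ab: "lie_abelian D (model_bracket T R)"
  shows "lie_ideal (model_algebra W R') (model_bracket T' R') (algebra_map ` D)"
    and "lie_abelian (algebra_map ` D) (model_bracket T' R')"
proof -
  have sD: "subspace D" and DL: "D \<subseteq> model_algebra V R"
    and id: "\<And>p q. p \<in> model_algebra V R \<Longrightarrow> q \<in> D \<Longrightarrow> model_bracket T R p q \<in> D"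
    using D by (auto simp: lie_ideal_def)
  have X: "subspace (selfmaps V \<times> V)" by (rule subspace_Times[OF subspace_selfmaps[OF V] V])
  have DX: "D \<subseteq> selfmaps V \<times> V" using DL model_algebra_subset by blast
  have "algebra_map ` D = span (algebra_map ` D)"
    using lin_map_on_span_image[OF algebra_map_linear X DX] sD span_eq_iff[of D] by metis
  then have "subspace (algebra_map ` D)" by (metis subspace_span)
  moreover have "model_bracket T' R' p' q' \<in> algebra_map ` D"
    if p': "p' \<in> model_algebra W R'" and q': "q' \<in> algebra_map ` D" for p' q'
  proof -
    obtain p q where pq: "p \<in> model_algebra V R" "p' = algebra_map p" "q \<in> D" "q' = algebra_map q"
      using p' q' algebra_map_image by blast
    then have "model_bracket T' R' p' q' = algebra_map (model_bracket T R p q)"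
      using algebra_map_bracket[OF _ subsetD[OF DL]] by simp
    then show ?thesis using id pq by blast
  qed
  ultimately show "lie_ideal (model_algebra W R') (model_bracket T' R') (algebra_map ` D)"
    unfolding lie_ideal_def using DL algebra_map_image by blast
  have "model_bracket T' R' (algebra_map p) (algebra_map q) = 0" if "p \<in> D" "q \<in> D" for p q
  proof -
    have "model_bracket T R p q = 0" using ab that by (auto simp: lie_abelian_def)
    then show ?thesis
      using algebra_map_bracket[of p q] DL that lin_map_on_zero_minus(1)[OF algebra_map_linear X]
      by auto
  qed
  then show "lie_abelian (algebra_map ` D) (model_bracket T' R')"
    unfolding lie_abelian_def by blast
qed

text \<open>The isomorphism of algebras carries abelian ideals to abelian ideals. Applied to \<open>F\<close> and to its
  inverse, the inclusion becomes an equality.\<close>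

lemma maximal_abelian_ideal_projection:
  assumes D: "maximal_abelian_ideal (model_algebra V R) (model_bracket T R) D"
    and D': "maximal_abelian_ideal (model_algebra W R') (model_bracket T' R') D'"
  shows "F ` snd ` D \<subseteq> snd ` D'"
proof -
  have "algebra_map ` D \<subseteq> D'"
    using D D' algebra_map_abelian_ideal[of D] unfolding maximal_abelian_ideal_def by blast
  then have "snd ` algebra_map ` D \<subseteq> snd ` D'" by (rule image_mono)
  moreover have "snd ` algebra_map ` D = F ` snd ` D" by (force simp: algebra_map_def)
  ultimately show ?thesis by simp
qed

end


section \<open>Reconstructing a transvection algebra from its infinitesimal model\<close>

lemma lie_algebraD:
  assumes "lie_algebra L br"
  shows "subspace L"
    and "x \<in> L \<Longrightarrow> y \<in> L \<Longrightarrow> br x y \<in> L"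
    and "x \<in> L \<Longrightarrow> y \<in> L \<Longrightarrow> z \<in> L \<Longrightarrow> br x (y + z) = br x y + br x z"
    and "x \<in> L \<Longrightarrow> y \<in> L \<Longrightarrow> z \<in> L \<Longrightarrow> br (x + y) z = br x z + br y z"
    and "x \<in> L \<Longrightarrow> y \<in> L \<Longrightarrow> br (c *\<^sub>R x) y = c *\<^sub>R br x y"
    and "x \<in> L \<Longrightarrow> br x 0 = 0" and "x \<in> L \<Longrightarrow> br 0 x = 0"
    and "x \<in> L \<Longrightarrow> y \<in> L \<Longrightarrow> br y x = - br x y"
    and "x \<in> L \<Longrightarrow> y \<in> L \<Longrightarrow> z \<in> L \<Longrightarrow> br (br x y) z = br x (br y z) - br y (br x z)"
proof -
  show L: "subspace L" using assms by (simp add: lie_algebra_def)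
  have l: "y \<in> L \<Longrightarrow> lin_map_on L L (\<lambda>x. br x y)"
    and r: "y \<in> L \<Longrightarrow> lin_map_on L L (br y)" for y
    using assms by (auto simp: lie_algebra_def)
  have ra: "br x (y + z) = br x y + br x z" and la: "br (x + y) z = br x z + br y z"
    if "x \<in> L" "y \<in> L" "z \<in> L" for x y z
    using that lin_map_onD(2)[OF l] lin_map_onD(2)[OF r] by auto
  have cl: "br x y \<in> L" if "x \<in> L" "y \<in> L" for x y
    using that lin_map_onD(1)[OF r] by auto
  have alt: "br x x = 0" if "x \<in> L" for x
    using assms that by (auto simp: lie_algebra_def)
  have anti: "br y x = - br x y" if "x \<in> L" "y \<in> L" for x y
  proof -
    have "0 = br (x + y) (x + y)" using alt subspace_add[OF L] that by simp
    also have "\<dots> = (br x x + br x y) + (br y x + br y y)"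
      using that by (simp only: ra la subspace_add[OF L] ac_simps)
    also have "\<dots> = br x y + br y x" using that alt by simp
    finally show ?thesis by (simp add: eq_neg_iff_add_eq_0 add.commute)
  qed
  show "x \<in> L \<Longrightarrow> y \<in> L \<Longrightarrow> br x y \<in> L" by (rule cl)
  show "x \<in> L \<Longrightarrow> y \<in> L \<Longrightarrow> z \<in> L \<Longrightarrow> br x (y + z) = br x y + br x z" by (rule ra)
  show "x \<in> L \<Longrightarrow> y \<in> L \<Longrightarrow> z \<in> L \<Longrightarrow> br (x + y) z = br x z + br y z" by (rule la)
  show "x \<in> L \<Longrightarrow> y \<in> L \<Longrightarrow> br (c *\<^sub>R x) y = c *\<^sub>R br x y"
    using lin_map_onD(3)[OF l] by simp
  show "x \<in> L \<Longrightarrow> br x 0 = 0" using lin_map_on_zero_minus(1)[OF r L] by simp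
  show "x \<in> L \<Longrightarrow> br 0 x = 0" using lin_map_on_zero_minus(1)[OF l L] by simp
  show "x \<in> L \<Longrightarrow> y \<in> L \<Longrightarrow> br y x = - br x y" by (rule anti)
  assume xyz: "x \<in> L" "y \<in> L" "z \<in> L"
  then have J: "br x (br y z) + br y (br z x) + br z (br x y) = 0"
    using assms by (simp add: lie_algebra_def)
  have "br z (br x y) = - br (br x y) z" using anti xyz cl by blast
  moreover have "br y (br z x) = - br y (br x z)"
    using anti[of x z] xyz lin_map_on_zero_minus(2)[OF r[of y] L, of "br x z"] cl by simp
  ultimately show "br (br x y) z = br x (br y z) - br y (br x z)" using J
    by (simp add: algebra_simps)
qed

locale natural_decomposition =
  fixes G :: "'a::real_vector set" and br H M g
  assumes nr: "naturally_reductive G br H M g"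
begin

lemma lie: "lie_algebra G br" and ds: "direct_sum_of G H M"
  and ip: "inner_product_on M g" and H_sub: "lie_subalgebra G br H"
  and HM: "h \<in> H \<Longrightarrow> x \<in> M \<Longrightarrow> br h x \<in> M"
  using nr by (auto simp: naturally_reductive_def)

lemma subspaces: "subspace G" "subspace H" "subspace M"
  using lie_algebraD(1)[OF lie] ds by (auto simp: direct_sum_of_def)

lemma subsets: "h \<in> H \<Longrightarrow> h \<in> G" "x \<in> M \<Longrightarrow> x \<in> G"
  using direct_sum_of_subset[OF ds] by auto

lemma isotropy_ad_selfmaps: "h \<in> H \<Longrightarrow> isotropy_ad br M h \<in> selfmaps M"
  using HM lie_algebraD(6)[OF lie] subsets
  by (auto simp: selfmaps_def isotropy_ad_def zero_off_def)

lemma curvature_of_selfmaps: "x \<in> M \<Longrightarrow> y \<in> M \<Longrightarrow> curvature_of br H M x y \<in> selfmaps M"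
  unfolding curvature_of_def
  by (intro subspace_neg[OF subspace_selfmaps[OF subspaces(3)]] isotropy_ad_selfmaps
      proj_along_in(2)[OF ds] lie_algebraD(2)[OF lie] subsets)

lemma torsion_of_in: "x \<in> M \<Longrightarrow> y \<in> M \<Longrightarrow> torsion_of br H M x y \<in> M"
  unfolding torsion_of_def
  by (intro subspace_neg[OF subspaces(3)] proj_along_in(1)[OF ds] lie_algebraD(2)[OF lie] subsets)

lemma proj_along_0: "proj_along H M 0 = 0"
  using proj_along_sum[OF ds subspace_0 subspace_0] subspaces by simp

lemma torsion_of_0: "x \<in> M \<Longrightarrow> torsion_of br H M 0 x = 0"
  using lie_algebraD(7)[OF lie] subsets by (simp add: torsion_of_def proj_along_0)

lemma bracket_of_M:
  assumes "x \<in> M" "y \<in> M"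
  shows "br x y = proj_along M H (br x y) - torsion_of br H M x y"
    and "proj_along M H (br x y) \<in> H"
    and "z \<in> M \<Longrightarrow> br (proj_along M H (br x y)) z = - curvature_of br H M x y z"
  using proj_along_in[OF ds, of "br x y"] lie_algebraD(2)[OF lie] subsets assms
  by (auto simp: torsion_of_def curvature_of_def isotropy_ad_def zero_off_def)

end

text \<open>The isotropy algebra acts faithfully on \<open>\<mm>\<close> with image the span of the curvature operators, so
  conjugation by an isomorphism \<open>S\<close> of the models defines a bijection \<open>\<rho> : \<hh>\<^sub>1 \<rightarrow> \<hh>\<^sub>2\<close>. By
  faithfulness, identities in \<open>\<hh>\<^sub>2\<close> may be tested on \<open>\<mm>\<^sub>2\<close>. This shows that \<open>\<tau> = \<rho> \<oplus> S\<close> respects brackets: the case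
  \<open>[\<hh>, \<hh>]\<close> is the Jacobi identity, \<open>[\<hh>, \<mm>]\<close> is the definition of \<open>\<rho>\<close>, and on \<open>[\<mm>, \<mm>]\<close> the
  components in \<open>\<hh>\<close> and in \<open>\<mm>\<close> are encoded by the curvature and the torsion.\<close>

lemma lie_iso_of_model_isometry:
  fixes G1 :: "'a::real_vector set" and G2 :: "'b::real_vector set"
  assumes nr1: "naturally_reductive G1 br1 H1 M1 g1" and nr2: "naturally_reductive G2 br2 H2 M2 g2"
    and tr1: "is_transvection_algebra br1 H1 M1" and tr2: "is_transvection_algebra br2 H2 M2"
    and S: "lin_map_on M1 M2 S" and bij: "bij_betw S M1 M2"
    and ST: "\<And>x y. x \<in> M1 \<Longrightarrow> y \<in> M1 \<Longrightarrow>
      S (torsion_of br1 H1 M1 x y) = torsion_of br2 H2 M2 (S x) (S y)"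
    and SR: "\<And>x y z. x \<in> M1 \<Longrightarrow> y \<in> M1 \<Longrightarrow> z \<in> M1 \<Longrightarrow>
      S (curvature_of br1 H1 M1 x y z) = curvature_of br2 H2 M2 (S x) (S y) (S z)"
  obtains \<tau> where "lie_iso G1 br1 G2 br2 \<tau>" and "\<tau> ` H1 = H2"
    and "\<And>x. x \<in> M1 \<Longrightarrow> \<tau> x = S x"
proof -
  interpret d1: natural_decomposition G1 br1 H1 M1 g1 by unfold_locales (rule nr1)
  interpret d2: natural_decomposition G2 br2 H2 M2 g2 by unfold_locales (rule nr2)
  let ?a1 = "isotropy_ad br1 M1" and ?a2 = "isotropy_ad br2 M2" and ?C = "induced_map M1 M2 S"
  note L1 = lie_algebraD[OF d1.lie] and L2 = lie_algebraD[OF d2.lie]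
  note V1 = d1.subspaces d1.subsets and V2 = d2.subspaces d2.subsets
  note Sin = lin_map_onD(1)[OF S] and Sadd = lin_map_onD(2)[OF S] and Ssc = lin_map_onD(3)[OF S]
  note Sdiff = lin_map_on_zero_minus(3)[OF S d1.subspaces(3)]
  note Sneg = lin_map_on_zero_minus(2)[OF S d1.subspaces(3)]
  note Spre = bij_betw_preimage[OF bij]
  have inj1: "inj_on ?a1 H1" and inj2: "inj_on ?a2 H2"
    and im1: "curvature_image M1 (curvature_of br1 H1 M1) = ?a1 ` H1"
    and im2: "curvature_image M2 (curvature_of br2 H2 M2) = ?a2 ` H2"
    using tr1 tr2 by (auto simp: is_transvection_algebra_def)
  have Cim: "?C ` ?a1 ` H1 = ?a2 ` H2"
    unfolding im1[symmetric] im2[symmetric]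
    by (rule induced_map_curvature_image[OF S d1.subspaces(3) bij])
      (auto intro: d1.curvature_of_selfmaps d2.curvature_of_selfmaps SR)
  define \<rho> where "\<rho> h = inv_into H2 ?a2 (?C (?a1 h))" for h
  have \<rho>_in: "\<rho> h \<in> H2" and \<rho>_a: "?a2 (\<rho> h) = ?C (?a1 h)" if "h \<in> H1" for h
  proof -
    have "?C (?a1 h) \<in> ?a2 ` H2" using Cim that by blast
    then show "\<rho> h \<in> H2" "?a2 (\<rho> h) = ?C (?a1 h)"
      unfolding \<rho>_def by (rule inv_into_into, rule f_inv_into_f)
  qed
  have \<rho>_br: "br2 (\<rho> h) (S x) = S (br1 h x)" if "h \<in> H1" "x \<in> M1" for h x
  proof -
    have "br2 (\<rho> h) (S x) = ?a2 (\<rho> h) (S x)"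
      using Sin[OF that(2)] by (simp add: isotropy_ad_def zero_off_def)
    also have "\<dots> = S (?a1 h x)" using \<rho>_a that induced_map_apply[OF bij] by simp
    finally show ?thesis using that by (simp add: isotropy_ad_def zero_off_def)
  qed
  \<comment> \<open>Faithfulness of the isotropy action: the test for all later identities in \<open>\<hh>\<^sub>2\<close>.\<close>
  have \<rho>_uniq: "\<rho> h = h'"
    if h: "h \<in> H1" "h' \<in> H2" and eq: "\<And>x. x \<in> M1 \<Longrightarrow> br2 h' (S x) = S (br1 h x)" for h h'
  proof -
    have "?C (?a1 h) = ?a2 h'"
      by (rule induced_map_eqI[OF bij])
        (use Sin eq in \<open>auto simp: isotropy_ad_def zero_off_def\<close>)
    then show ?thesis using \<rho>_a[OF h(1)] \<rho>_in[OF h(1)] h(2) inj2 by (metis inj_onD)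
  qed
  have \<rho>_lin: "lin_map_on H1 H2 \<rho>"
    unfolding lin_map_on_def
  proof (intro conjI ballI allI)
    show "\<rho> ` H1 \<subseteq> H2" using \<rho>_in by blast
  next
    fix h k assume h: "h \<in> H1" "k \<in> H1"
    show "\<rho> (h + k) = \<rho> h + \<rho> k"
      by (rule \<rho>_uniq)
        (use h \<rho>_in Sin d1.HM in \<open>auto simp: L1(4) L2(4) V1 V2 \<rho>_br Sadd subspace_add\<close>)
  next
    fix c h assume h: "h \<in> H1"
    show "\<rho> (c *\<^sub>R h) = c *\<^sub>R \<rho> h"
      by (rule \<rho>_uniq)
        (use h \<rho>_in Sin d1.HM in \<open>auto simp: L1(5) L2(5) V1 V2 \<rho>_br Ssc subspace_scale\<close>)
  qed
  have \<rho>_inj: "h = k" if "h \<in> H1" "k \<in> H1" "\<rho> h = \<rho> k" for h k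
  proof -
    have "?a1 h x = ?a1 k x" for x
    proof (cases "x \<in> M1")
      case True
      then have "S (br1 h x) = S (br1 k x)" using \<rho>_br that by metis
      then show ?thesis
        using True that d1.HM inj_onD[OF bij_betw_imp_inj_on[OF bij]]
        by (simp add: isotropy_ad_def zero_off_def)
    qed (simp add: isotropy_ad_def zero_off_def)
    then show ?thesis using inj1 that by (metis inj_onD ext)
  qed
  have \<rho>_surj: "\<exists>h\<in>H1. h' = \<rho> h" if "h' \<in> H2" for h'
  proof -
    have "?a2 h' \<in> ?C ` ?a1 ` H1" unfolding Cim using that by (rule imageI)
    then obtain h where "h \<in> H1" "?a2 h' = ?C (?a1 h)" by (elim imageE) simp
    then have "?a2 h' = ?a2 (\<rho> h)" using \<rho>_a by simp
    then have "h' = \<rho> h" using inj_onD[OF inj2] that \<rho>_in[OF \<open>h \<in> H1\<close>] by blast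
    then show ?thesis using \<open>h \<in> H1\<close> by blast
  qed
  have \<rho>_hom: "\<rho> (br1 h k) = br2 (\<rho> h) (\<rho> k)" if h: "h \<in> H1" "k \<in> H1" for h k
  proof (rule \<rho>_uniq)
    show "br1 h k \<in> H1" "br2 (\<rho> h) (\<rho> k) \<in> H2"
      using d1.H_sub d2.H_sub h \<rho>_in by (auto simp: lie_subalgebra_def)
    fix x assume x: "x \<in> M1"
    have "br2 (br2 (\<rho> h) (\<rho> k)) (S x) = br2 (\<rho> h) (br2 (\<rho> k) (S x)) - br2 (\<rho> k) (br2 (\<rho> h) (S x))"
      using h x \<rho>_in Sin by (intro L2(9)) (auto simp: V2)
    also have "\<dots> = S (br1 h (br1 k x) - br1 k (br1 h x))"
      using h x d1.HM by (simp add: \<rho>_br Sdiff)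
    also have "br1 h (br1 k x) - br1 k (br1 h x) = br1 (br1 h k) x"
      using h x by (intro L1(9)[symmetric]) (auto simp: V1)
    finally show "br2 (br2 (\<rho> h) (\<rho> k)) (S x) = S (br1 (br1 h k) x)" .
  qed
  have \<rho>_curv: "\<rho> (proj_along M1 H1 (br1 x y)) = proj_along M2 H2 (br2 (S x) (S y))"
    if xy: "x \<in> M1" "y \<in> M1" for x y
  proof (rule \<rho>_uniq)
    fix z assume "z \<in> M1"
    then show "br2 (proj_along M2 H2 (br2 (S x) (S y))) (S z)
        = S (br1 (proj_along M1 H1 (br1 x y)) z)"
      using xy Sin d1.curvature_of_selfmaps[OF xy]
      by (simp add: d1.bracket_of_M(3) d2.bracket_of_M(3) SR Sneg selfmaps_def)
  qed (use xy Sin d1.bracket_of_M(2) d2.bracket_of_M(2) in auto)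
  define \<tau> where "\<tau> v = \<rho> (proj_along M1 H1 v) + S (proj_along H1 M1 v)" for v
  have \<tau>_sum: "\<tau> (h + x) = \<rho> h + S x" if "h \<in> H1" "x \<in> M1" for h x
    using proj_along_sum[OF d1.ds that] proj_along_sum[OF direct_sum_of_commute[OF d1.ds] that(2,1)]
    by (simp add: \<tau>_def add.commute)
  have S0: "S 0 = 0" and \<rho>0: "\<rho> 0 = 0"
    using lin_map_on_zero_minus(1)[OF S] lin_map_on_zero_minus(1)[OF \<rho>_lin] V1 by auto
  have \<tau>_H: "\<tau> h = \<rho> h" if "h \<in> H1" for h
    using \<tau>_sum[OF that subspace_0[OF V1(3)]] S0 by simp
  have \<tau>_M: "\<tau> x = S x" if "x \<in> M1" for x
    using \<tau>_sum[OF subspace_0[OF V1(2)] that] \<rho>0 by simp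
  have dec1: "\<exists>h x. h \<in> H1 \<and> x \<in> M1 \<and> v = h + x" if "v \<in> G1" for v
    using d1.ds that by (auto simp: direct_sum_of_def sum_space_def)
  have dec2: "\<exists>h x. h \<in> H2 \<and> x \<in> M2 \<and> v = h + x" if "v \<in> G2" for v
    using d2.ds that by (auto simp: direct_sum_of_def sum_space_def)
  have \<tau>_lin: "lin_map_on G1 G2 \<tau>"
    unfolding lin_map_on_def
  proof (intro conjI ballI allI)
    show "\<tau> ` G1 \<subseteq> G2"
    proof
      fix w assume "w \<in> \<tau> ` G1"
      then obtain h x where "h \<in> H1" "x \<in> M1" "w = \<tau> (h + x)" using dec1 by blast
      then show "w \<in> G2" using \<tau>_sum \<rho>_in Sin V2 by (simp add: subspace_add)
    qed
  next
    fix u v assume "u \<in> G1" "v \<in> G1"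
    then obtain h x k y where e: "h \<in> H1" "x \<in> M1" "u = h + x" "k \<in> H1" "y \<in> M1" "v = k + y"
      using dec1 by metis
    have "u + v = (h + k) + (x + y)" using e by simp
    then have "\<tau> (u + v) = \<rho> (h + k) + S (x + y)"
      using e \<tau>_sum[of "h + k" "x + y"] V1 by (simp only: subspace_add)
    then show "\<tau> (u + v) = \<tau> u + \<tau> v"
      using e lin_map_onD(2)[OF \<rho>_lin] by (simp add: \<tau>_sum Sadd)
  next
    fix c v assume "v \<in> G1"
    then obtain h x where e: "h \<in> H1" "x \<in> M1" "v = h + x" using dec1 by blast
    have "c *\<^sub>R v = c *\<^sub>R h + c *\<^sub>R x" using e by (simp add: scaleR_add_right)
    then have "\<tau> (c *\<^sub>R v) = \<rho> (c *\<^sub>R h) + S (c *\<^sub>R x)"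
      using e \<tau>_sum[of "c *\<^sub>R h" "c *\<^sub>R x"] V1 by (simp only: subspace_scale)
    then show "\<tau> (c *\<^sub>R v) = c *\<^sub>R \<tau> v"
      using e lin_map_onD(3)[OF \<rho>_lin] by (simp add: \<tau>_sum Ssc scaleR_add_right)
  qed
  have \<tau>_inj: "inj_on \<tau> G1"
  proof (rule inj_onI)
    fix u v assume "u \<in> G1" "v \<in> G1" and eq: "\<tau> u = \<tau> v"
    then obtain h x k y where e: "h \<in> H1" "x \<in> M1" "u = h + x" "k \<in> H1" "y \<in> M1" "v = k + y"
      using dec1 by metis
    have eq': "\<rho> h + S x = \<rho> k + S y" using eq e \<tau>_sum by simp
    have "S x = S y"
      using proj_along_sum[OF d2.ds \<rho>_in[OF e(1)] Sin[OF e(2)]]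
        proj_along_sum[OF d2.ds \<rho>_in[OF e(4)] Sin[OF e(5)]] eq' by simp
    then have "x = y" "h = k"
      using eq' e \<rho>_inj inj_onD[OF bij_betw_imp_inj_on[OF bij]] by auto
    then show "u = v" using e by simp
  qed
  have \<tau>_surj: "\<tau> ` G1 = G2"
  proof
    show "\<tau> ` G1 \<subseteq> G2" using \<tau>_lin by (simp add: lin_map_on_def)
    show "G2 \<subseteq> \<tau> ` G1"
    proof
      fix w assume "w \<in> G2"
      then obtain h' x' where "h' \<in> H2" "x' \<in> M2" "w = h' + x'" using dec2 by blast
      then obtain h x where e: "h \<in> H1" "x \<in> M1" "w = \<rho> h + S x" using \<rho>_surj Spre by metis
      then have "w = \<tau> (h + x)" "h + x \<in> G1" using \<tau>_sum V1 by (simp_all add: subspace_add)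
      then show "w \<in> \<tau> ` G1" by blast
    qed
  qed
  note \<tau>in = lin_map_onD(1)[OF \<tau>_lin] and \<tau>add = lin_map_onD(2)[OF \<tau>_lin]
  note \<tau>neg = lin_map_on_zero_minus(2)[OF \<tau>_lin V1(1)]
  have HH: "\<tau> (br1 h k) = br2 (\<tau> h) (\<tau> k)" if "h \<in> H1" "k \<in> H1" for h k
    using that \<rho>_hom \<tau>_H d1.H_sub by (auto simp: lie_subalgebra_def)
  have HMb: "\<tau> (br1 h x) = br2 (\<tau> h) (\<tau> x)" if "h \<in> H1" "x \<in> M1" for h x
    using that \<rho>_br \<tau>_H \<tau>_M d1.HM by auto
  have MHb: "\<tau> (br1 x h) = br2 (\<tau> x) (\<tau> h)" if "h \<in> H1" "x \<in> M1" for h x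
    using HMb[OF that] that L1(8)[of h x] L2(8)[of "\<tau> h" "\<tau> x"] L1(2)[of h x] \<tau>in
    by (simp add: V1 \<tau>neg)
  have MM: "\<tau> (br1 x y) = br2 (\<tau> x) (\<tau> y)" if xy: "x \<in> M1" "y \<in> M1" for x y
  proof -
    have "br1 x y = proj_along M1 H1 (br1 x y) + - torsion_of br1 H1 M1 x y"
      using d1.bracket_of_M(1)[OF xy] by simp
    then have "\<tau> (br1 x y) = \<rho> (proj_along M1 H1 (br1 x y)) + S (- torsion_of br1 H1 M1 x y)"
      using \<tau>_sum d1.bracket_of_M(2)[OF xy] d1.torsion_of_in[OF xy] V1
      by (metis subspace_neg)
    also have "\<dots> = proj_along M2 H2 (br2 (S x) (S y)) - torsion_of br2 H2 M2 (S x) (S y)"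
      using \<rho>_curv[OF xy] ST[OF xy] Sneg d1.torsion_of_in[OF xy] by simp
    also have "\<dots> = br2 (S x) (S y)" using d2.bracket_of_M(1) Sin xy by metis
    finally show ?thesis using \<tau>_M xy by simp
  qed
  have \<tau>_hom: "\<tau> (br1 u v) = br2 (\<tau> u) (\<tau> v)" if "u \<in> G1" "v \<in> G1" for u v
  proof -
    obtain h x k y where e: "h \<in> H1" "x \<in> M1" "u = h + x" "k \<in> H1" "y \<in> M1" "v = k + y"
      using dec1 \<open>u \<in> G1\<close> \<open>v \<in> G1\<close> by metis
    have m: "h \<in> G1" "x \<in> G1" "k \<in> G1" "y \<in> G1" using e V1 by auto
    have "br1 u v = (br1 h k + br1 h y) + (br1 x k + br1 x y)"
      using m e by (simp add: L1(3,4) subspace_add[OF V1(1)])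
    then have "\<tau> (br1 u v) = (br2 (\<tau> h) (\<tau> k) + br2 (\<tau> h) (\<tau> y)) + (br2 (\<tau> x) (\<tau> k) + br2 (\<tau> x) (\<tau> y))"
      using m e by (simp add: \<tau>add L1(2) subspace_add[OF V1(1)] HH HMb MHb MM)
    also have "\<dots> = br2 (\<tau> u) (\<tau> v)"
      using m e by (simp add: L2(3,4) subspace_add[OF V2(1)] \<tau>add \<tau>in)
    finally show ?thesis .
  qed
  have "lie_iso G1 br1 G2 br2 \<tau>"
    using \<tau>_lin \<tau>_inj \<tau>_surj \<tau>_hom by (simp add: lie_iso_def bij_betw_def)
  moreover have "\<tau> ` H1 = H2"
  proof
    show "\<tau> ` H1 \<subseteq> H2" using \<rho>_in \<tau>_H by auto
    show "H2 \<subseteq> \<tau> ` H1" using \<rho>_surj \<tau>_H by (metis image_eqI subsetI)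
  qed
  ultimately show thesis using that \<tau>_M by blast
qed

section \<open>Torsion and curvature of the extension\<close>

lemma sum_scaleR_apply:
  fixes f :: "'i \<Rightarrow> 'x \<Rightarrow> 'y::real_vector"
  shows "(\<Sum>i\<in>A. c i *\<^sub>R f i) w = (\<Sum>i\<in>A. c i *\<^sub>R f i w)"
  by (induction A rule: infinite_finite_induct) (auto simp: scaleR_fun_def)

locale extended_decomposition = natural_decomposition G br H M g
  for G :: "'a::real_vector set" and br H M g +
  fixes K :: "'a s_elem set" and B and E :: "'a s_elem set"
  assumes ed: "extension_data G br H M g K B" and onb: "orthonormal_basis K B E"
begin

lemma K: "subspace K" and ipB: "inner_product_on K B"
  and K_s: "K \<subseteq> s_algebra G br H M g"
  and s_bracket_in: "k \<in> K \<Longrightarrow> l \<in> K \<Longrightarrow> s_bracket k l \<in> K"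
  and B_inv: "k \<in> K \<Longrightarrow> l \<in> K \<Longrightarrow> k' \<in> K \<Longrightarrow> B (s_bracket k l) k' + B l (s_bracket k k') = 0"
  using ed by (auto simp: extension_data_def lie_subalgebra_def)

lemma E: "E \<subseteq> K"
  using onb span_superset[of E] by (auto simp: orthonormal_basis_def)

lemmas gD = inner_product_onD[OF ip subspaces(3)]
lemmas BD = inner_product_onD[OF ipB K]

lemma zeros: "0 \<in> M" "0 \<in> K"
  using subspace_0 subspaces(3) K by auto

text \<open>By invariance of \<open>B\<close>, the bracket \<open>[k, 0]\<close> is orthogonal to all of \<open>K\<close>.\<close>

lemma s_bracket_0:
  assumes "k \<in> K" shows "s_bracket k 0 = 0"
proof -
  have "B (s_bracket k 0) (s_bracket k 0) = 0"
    using B_inv[OF assms zeros(2), of "s_bracket k 0"] BD(5) s_bracket_in assms zeros by simp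
  then show ?thesis using BD(4) s_bracket_in assms zeros by blast
qed

lemma derivation_part:
  assumes "G \<noteq> {0}" and "k \<in> K"
  shows "snd k = 0" and "fst k \<in> endos G" and "\<And>h. h \<in> H \<Longrightarrow> fst k h = 0"
    and "rep_phi M k \<in> so_on M g"
  using K_s assms by (auto simp: s_algebra_def derivations_def rep_phi_def)

text \<open>If \<open>\<gg> = {0}\<close>, elements of \<open>\<ss>(\<gg>)\<close> are matrices whose first component is \<open>0\<close>, so they act by \<open>0\<close>
  on \<open>\<mm>\<close>.\<close>

lemma rep_phi_so: "k \<in> K \<Longrightarrow> rep_phi M k \<in> so_on M g"
proof (cases "G = {0}")
  case True
  assume "k \<in> K"
  then have "fst k = 0" using K_s True by (auto simp: s_algebra_def)
  then have "rep_phi M k = (\<lambda>x. 0)" by (auto simp: rep_phi_def zero_off_def)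
  then show ?thesis
    using gD(5,6) zeros by (simp add: so_on_def endos_def lin_map_on_def image_subset_iff)
qed (rule derivation_part)

lemma rep_phi_in: "k \<in> K \<Longrightarrow> x \<in> M \<Longrightarrow> rep_phi M k x \<in> M"
  and rep_phi_zero: "k \<in> K \<Longrightarrow> rep_phi M k 0 = 0"
  and rep_phi_skew: "k \<in> K \<Longrightarrow> x \<in> M \<Longrightarrow> y \<in> M \<Longrightarrow> g (rep_phi M k x) y = - g x (rep_phi M k y)"
  using rep_phi_so[of k] subspaces(3) lin_map_on_zero_minus(1)[of M M "rep_phi M k"]
  by (auto simp: so_on_def endos_def lin_map_on_def)

lemma rep_phi_sum: "rep_phi M (\<Sum>e\<in>A. c e *\<^sub>R e) x = (\<Sum>e\<in>A. c e *\<^sub>R rep_phi M e x)"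
  by (induction A rule: infinite_finite_induct)
    (auto simp: rep_phi_def zero_off_def scaleR_fun_def)

text \<open>The element of \<open>\<kk>\<close> that represents the linear form \<open>k \<mapsto> g(\<phi>(k)x, y)\<close> with respect to \<open>B\<close>: the moment
  map of the representation \<open>\<phi>\<close>, polarised. It is the \<open>\<nn>\<close>-component of the torsion on \<open>\<mm>\<close>.\<close>

definition moment :: "'a \<Rightarrow> 'a \<Rightarrow> 'a s_elem" where
  "moment x y = (\<Sum>e\<in>E. g (rep_phi M e x) y *\<^sub>R e)"

lemma moment_in: "moment x y \<in> K"
  unfolding moment_def using E by (intro subspace_sum[OF K] subspace_scale[OF K]) auto

lemma moment_0: "y \<in> M \<Longrightarrow> moment 0 y = 0"
  unfolding moment_def using E rep_phi_zero gD(5) by (intro sum.neutral) auto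

lemma sum_rep_phi:
  assumes "k \<in> K" "x \<in> M" "y \<in> M"
  shows "(\<Sum>e\<in>E. g (rep_phi M e x) y * B e k) = g (rep_phi M k x) y"
proof -
  have "finite E" using onb by (simp add: orthonormal_basis_def)
  have "rep_phi M k x = (\<Sum>e\<in>E. B e k *\<^sub>R rep_phi M e x)"
    using arg_cong[OF orthonormal_basis_expansion[OF onb ipB K assms(1)], of "\<lambda>l. rep_phi M l x"]
    unfolding rep_phi_sum .
  moreover have "g (\<Sum>e\<in>A. B e k *\<^sub>R rep_phi M e x) y = (\<Sum>e\<in>A. g (rep_phi M e x) y * B e k)"
    if "A \<subseteq> E" for A
    using finite_subset[OF that \<open>finite E\<close>] that
  proof (induction A rule: finite_induct)
    case (insert e A)
    have "(\<Sum>e\<in>A. B e k *\<^sub>R rep_phi M e x) \<in> M"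
      using insert E rep_phi_in assms
      by (intro subspace_sum[OF subspaces(3)] subspace_scale[OF subspaces(3)]) auto
    moreover have "rep_phi M e x \<in> M"
      using insert.prems by (intro rep_phi_in subsetD[OF E] assms(2)) simp
    ultimately show ?case
      using insert assms subspace_scale[OF subspaces(3)] by (simp add: gD(2,3))
  qed (use gD(5) assms in auto)
  ultimately show ?thesis by simp
qed

text \<open>In \<open>\<Sum>\<^sub>i \<phi>(k\<^sub>i) \<and> n\<^sub>i\<close> the three cyclic terms pair one argument with the basis of \<open>\<nn>\<close>. When that
  argument is the third, the sum is the moment; when it is one of the first two, the sum collapses
  to \<open>\<phi>\<close> by expanding this argument in the orthonormal basis.\<close>

lemma ext_torsion_eq:
  assumes k: "k \<in> K" "k' \<in> K" and x: "x \<in> M" "x' \<in> M"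
  shows "ext_torsion br H M g K B E (k, x) (k', x') =
    (2 *\<^sub>R s_bracket k k' + moment x x',
     torsion_of br H M x x' + rep_phi M k x' - rep_phi M k' x)" (is "_ = (?a, ?b)")
  unfolding ext_torsion_def
proof (rule sharp_on_eqI[OF inner_product_on_ext_inner[OF ipB ip K subspaces(3)]
      subspace_Times[OF K subspaces(3)]])
  have mem: "s_bracket k k' \<in> K" "2 *\<^sub>R s_bracket k k' \<in> K"
    "torsion_of br H M x x' \<in> M" "rep_phi M k x' \<in> M" "rep_phi M k' x \<in> M"
    "torsion_of br H M x x' + rep_phi M k x' \<in> M"
    using assms s_bracket_in torsion_of_in rep_phi_in subspace_scale[OF K]
      subspace_add[OF subspaces(3)] by auto
  show "(?a, ?b) \<in> K \<times> M"
    using mem moment_in subspace_add[OF K] subspace_diff[OF subspaces(3)] by auto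
  fix w assume w: "w \<in> K \<times> M"
  obtain l z where lz: "w = (l, z)" "l \<in> K" "z \<in> M" using w by auto
  have "ext_torsion_form br H M g K B E (k, x) (k', x') w =
     g (torsion_of br H M x x') z +
     (\<Sum>e\<in>E. g (rep_phi M e x) x' * B e l + g (rep_phi M e x') z * B e k
        + g (rep_phi M e z) x * B e k') + 2 * B (s_bracket k k') l"
  proof -
    have "wedge21 (\<lambda>u v. ext_inner B g (rep_phi_ext K M e u) v)
        (\<lambda>v. ext_inner B g (e, 0) v) (k, x) (k', x') w
      = g (rep_phi M e x) x' * B e l + g (rep_phi M e x') z * B e k + g (rep_phi M e z) x * B e k'"
      if "e \<in> E" for e
      using that E assms lz BD(5) gD(5)
      by (simp add: wedge21_def ext_inner_def rep_phi_ext_def zero_off_def)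
    then show ?thesis unfolding ext_torsion_form_def lz by simp
  qed
  also have "\<dots> = g (torsion_of br H M x x') z + (B (moment x x') l + g (rep_phi M k x') z
      + g (rep_phi M k' z) x) + 2 * B (s_bracket k k') l"
    unfolding moment_def
    using inner_product_on_sum[OF ipB K E lz(2)] sum_rep_phi assms lz by (simp add: sum.distrib)
  also have "g (rep_phi M k' z) x = - g (rep_phi M k' x) z"
    using rep_phi_skew[of k' z x] gD(1)[of z "rep_phi M k' x"] assms lz mem by simp
  also have "g (torsion_of br H M x x') z + (B (moment x x') l + g (rep_phi M k x') z
      + - g (rep_phi M k' x) z) + 2 * B (s_bracket k k') l = ext_inner B g (?a, ?b) w"
    using mem lz moment_in by (simp add: ext_inner_def BD(2,3) gD(2,7))
  finally show "ext_inner B g (?a, ?b) w = ext_torsion_form br H M g K B E (k, x) (k', x') w" ..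
qed

lemma ext_torsion_in: "u \<in> K \<times> M \<Longrightarrow> v \<in> K \<times> M \<Longrightarrow> ext_torsion br H M g K B E u v \<in> K \<times> M"
  using s_bracket_in torsion_of_in rep_phi_in moment_in K subspaces(3)
  by (auto simp: ext_torsion_eq subspace_scale subspace_add subspace_diff)

lemma ext_torsion_M:
  assumes "x \<in> M" "y \<in> M"
  shows "ext_torsion br H M g K B E (0, x) (0, y) = (moment x y, torsion_of br H M x y)"
  using ext_torsion_eq[OF zeros(2,2) assms] s_bracket_0[OF zeros(2)]
  by (simp add: rep_phi_def zero_off_def)

lemma ext_torsion_K:
  assumes "k \<in> K" "l \<in> K"
  shows "ext_torsion br H M g K B E (k, 0) (l, 0) = (2 *\<^sub>R s_bracket k l, 0)"
  using ext_torsion_eq[OF assms zeros(1,1)] moment_0[OF zeros(1)] torsion_of_0[OF zeros(1)]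
    rep_phi_zero assms by simp

lemma ext_torsion_KM:
  assumes "k \<in> K" "x \<in> M"
  shows "ext_torsion br H M g K B E (k, 0) (0, x) = (0, rep_phi M k x)"
  using ext_torsion_eq[OF assms(1) zeros(2,1) assms(2)] moment_0[OF assms(2)]
    torsion_of_0[OF assms(2)] rep_phi_zero[OF zeros(2)] s_bracket_0[OF assms(1)] by simp

lemma ext_curvature_selfmaps:
  assumes "u \<in> K \<times> M" "v \<in> K \<times> M"
  shows "ext_curvature br H M g K B E u v \<in> selfmaps (K \<times> M)"
proof -
  have "curvature_of br H M (snd u) (snd v) \<in> selfmaps M"
    using curvature_of_selfmaps assms by auto
  then have "zero_off (K \<times> M) (\<lambda>w. (0, curvature_of br H M (snd u) (snd v) (snd w)))
      \<in> selfmaps (K \<times> M)"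
    using zeros by (auto simp: selfmaps_def zero_off_def zero_prod_def)
  moreover have "rep_psi K M e \<in> selfmaps (K \<times> M)" if "e \<in> E" for e
  proof -
    have "e \<in> K" using that E by blast
    then show ?thesis
      by (simp add: selfmaps_def zero_off_def rep_psi_def mem_Times_iff s_bracket_in rep_phi_in
          s_bracket_0 rep_phi_zero zero_prod_def[symmetric])
  qed
  ultimately show ?thesis
    unfolding ext_curvature_def
    using subspace_selfmaps[OF subspace_Times[OF K subspaces(3)]]
    by (intro subspace_add subspace_sum subspace_scale) auto
qed

text \<open>On \<open>\<mm>\<close> the basis-dependent part of the curvature is the action of the moment, which is itself a
  torsion component. This is what makes \<open>R\<^sub>0\<close> recoverable from \<open>(T, R)\<close> and the splitting.\<close>

lemma ext_curvature_M:
  assumes "x \<in> M" "y \<in> M" "z \<in> M"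
  shows "snd (ext_curvature br H M g K B E (0, x) (0, y) (0, z))
    = curvature_of br H M x y z + rep_phi M (moment x y) z"
proof -
  have "ext_inner B g (rep_psi K M e (0, x)) (0, y) = g (rep_phi M e x) y" if "e \<in> E" for e
  proof -
    have "e \<in> K" using that E by blast
    then have "B (s_bracket e 0) 0 = 0" by (intro BD(6) s_bracket_in zeros)
    then show ?thesis using assms zeros by (simp add: ext_inner_def rep_psi_def zero_off_def)
  qed
  moreover have "snd (rep_psi K M e (0, z)) = rep_phi M e z" for e
    using assms zeros by (simp add: rep_psi_def zero_off_def)
  ultimately have "snd (\<Sum>e\<in>E. ext_inner B g (rep_psi K M e (0, x)) (0, y) *\<^sub>R rep_psi K M e (0, z))
      = rep_phi M (moment x y) z"
    by (simp add: moment_def rep_phi_sum snd_sum)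
  then show ?thesis
    using assms zeros by (simp add: ext_curvature_def sum_scaleR_apply zero_off_def)
qed

end


section \<open>Uniqueness of the canonical base space\<close>

theorem proposition4p6:
  fixes G1 H1 M1 M01 A1 :: "'a::real_vector set" and br1 :: "'a \<Rightarrow> 'a \<Rightarrow> 'a"
    and g1 :: "'a \<Rightarrow> 'a \<Rightarrow> real"
    and K1 E1 :: "'a s_elem set" and B1 :: "'a s_elem \<Rightarrow> 'a s_elem \<Rightarrow> real"
    and G2 H2 M2 M02 A2 :: "'b::real_vector set" and br2 :: "'b \<Rightarrow> 'b \<Rightarrow> 'b"
    and g2 :: "'b \<Rightarrow> 'b \<Rightarrow> real"
    and K2 E2 :: "'b s_elem set" and B2 :: "'b s_elem \<Rightarrow> 'b s_elem \<Rightarrow> real"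
  assumes "naturally_reductive G1 br1 H1 M1 g1" and "naturally_reductive G2 br2 H2 M2 g2"
    and "is_transvection_algebra br1 H1 M1" and "is_transvection_algebra br2 H2 M2"
    and "semisimple_plus_flat G1 br1 H1 M1 M01 A1"
    and "semisimple_plus_flat G2 br2 H2 M2 M02 A2"
    and "extension_data G1 br1 H1 M1 g1 K1 B1" and "extension_data G2 br2 H2 M2 g2 K2 B2"
    and "orthonormal_basis K1 B1 E1" and "orthonormal_basis K2 B2 E2"
    and "canonical_base_space br1 H1 M1 g1 K1 B1 E1"
    and "canonical_base_space br2 H2 M2 g2 K2 B2 E2"
    and "infinitesimal_model_iso
           (K1 \<times> M1) (ext_inner B1 g1)
           (ext_torsion br1 H1 M1 g1 K1 B1 E1) (ext_curvature br1 H1 M1 g1 K1 B1 E1)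
           (K2 \<times> M2) (ext_inner B2 g2)
           (ext_torsion br2 H2 M2 g2 K2 B2 E2) (ext_curvature br2 H2 M2 g2 K2 B2 E2)"
  shows "\<exists>\<tau>. lie_iso G1 br1 G2 br2 \<tau> \<and> \<tau> ` H1 = H2 \<and> lin_isometry_on M1 g1 M2 g2 \<tau> \<and>
           (if G1 = {0} \<and> G2 = {0}
            then \<exists>\<theta>. lie_iso K1 s_bracket K2 s_bracket \<theta> \<and> lin_isometry_on K1 B1 K2 B2 \<theta>
            else lin_isometry_on K1 B1 K2 B2 (\<lambda>(f, X). (induced_map G1 G2 \<tau> f, X)))"
proof -
  let ?T1 = "ext_torsion br1 H1 M1 g1 K1 B1 E1" and ?R1 = "ext_curvature br1 H1 M1 g1 K1 B1 E1"
  let ?T2 = "ext_torsion br2 H2 M2 g2 K2 B2 E2" and ?R2 = "ext_curvature br2 H2 M2 g2 K2 B2 E2"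
  interpret e1: extended_decomposition G1 br1 H1 M1 g1 K1 B1 E1
    by unfold_locales (use assms in auto)
  interpret e2: extended_decomposition G2 br2 H2 M2 g2 K2 B2 E2
    by unfold_locales (use assms in auto)
  note V1 = e1.subspaces e1.K subspace_0[OF e1.subspaces(3)] subspace_0[OF e1.K]
  note V2 = e2.subspaces e2.K subspace_0[OF e2.subspaces(3)] subspace_0[OF e2.K]
  obtain F where iso: "lin_isometry_on (K1 \<times> M1) (ext_inner B1 g1) (K2 \<times> M2) (ext_inner B2 g2) F"
    and FT: "\<And>x y. x \<in> K1 \<times> M1 \<Longrightarrow> y \<in> K1 \<times> M1 \<Longrightarrow> F (?T1 x y) = ?T2 (F x) (F y)"
    and FR: "\<And>x y z. x \<in> K1 \<times> M1 \<Longrightarrow> y \<in> K1 \<times> M1 \<Longrightarrow> z \<in> K1 \<times> M1 \<Longrightarrow>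
      F (?R1 x y z) = ?R2 (F x) (F y) (F z)"
    using assms(13) unfolding infinitesimal_model_iso_def by blast
  have F: "lin_map_on (K1 \<times> M1) (K2 \<times> M2) F" and bij: "bij_betw F (K1 \<times> M1) (K2 \<times> M2)"
    and Fip: "\<And>x y. x \<in> K1 \<times> M1 \<Longrightarrow> y \<in> K1 \<times> M1 \<Longrightarrow>
      ext_inner B2 g2 (F x) (F y) = ext_inner B1 g1 x y"
    using iso by (auto simp: lin_isometry_on_def)
  interpret iso: model_isomorphism "K1 \<times> M1" ?T1 ?R1 "K2 \<times> M2" ?T2 ?R2 F
    by unfold_locales
      (use F bij FT FR e1.ext_torsion_in e2.ext_torsion_in e1.ext_curvature_selfmaps
        e2.ext_curvature_selfmaps subspace_Times V1 V2 in auto)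
  interpret inv: model_isomorphism "K2 \<times> M2" ?T2 ?R2 "K1 \<times> M1" ?T1 ?R1 "inv_into (K1 \<times> M1) F"
    by (rule iso.inverse)
  obtain D1 where D1: "maximal_abelian_ideal (model_algebra (K1 \<times> M1) ?R1) (model_bracket ?T1 ?R1) D1"
    and D1K: "snd ` D1 = K1 \<times> {0}"
    using assms(11) by (auto simp: canonical_base_space_def Let_def)
  obtain D2 where D2: "maximal_abelian_ideal (model_algebra (K2 \<times> M2) ?R2) (model_bracket ?T2 ?R2) D2"
    and D2K: "snd ` D2 = K2 \<times> {0}"
    using assms(12) by (auto simp: canonical_base_space_def Let_def)
  \<comment> \<open>The two components of \<open>F\<close> with respect to \<open>\<nn> \<oplus> \<mm>\<close>. That \<open>F\<close> respects \<open>\<nn>\<close> comes from the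
    maximal abelian ideals; that it respects \<open>\<mm>\<close> comes from \<open>\<mm> = \<nn>\<^sup>\<bottom>\<close>.\<close>
  define \<theta> where "\<theta> k = fst (F (k, 0))" for k
  define S where "S x = snd (F (0, x))" for x
  have F_K: "F (k, 0) = (\<theta> k, 0) \<and> \<theta> k \<in> K2" if "k \<in> K1" for k
  proof -
    have "F (k, 0) \<in> K2 \<times> {0}"
      using iso.maximal_abelian_ideal_projection[OF D1 D2] that unfolding D1K D2K by blast
    then show ?thesis by (auto simp: \<theta>_def)
  qed
  have K_pre: "\<exists>k\<in>K1. F (k, 0) = (k', 0)" if "k' \<in> K2" for k'
  proof -
    have "inv_into (K1 \<times> M1) F (k', 0) \<in> K1 \<times> {0}"
      using inv.maximal_abelian_ideal_projection[OF D2 D1] that unfolding D1K D2K by blast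
    moreover have "F (inv_into (K1 \<times> M1) F (k', 0)) = (k', 0)"
      using bij that V2 by (simp add: bij_betw_def f_inv_into_f)
    ultimately show ?thesis by auto
  qed
  have F_M: "F (0, x) = (0, S x) \<and> S x \<in> M2" if x: "x \<in> M1" for x
  proof -
    obtain k m where km: "F (0, x) = (k, m)" "k \<in> K2" "m \<in> M2"
      using lin_map_onD(1)[OF F, of "(0, x)"] x V1 by auto
    obtain k' where k': "k' \<in> K1" "F (k', 0) = (k, 0)" using K_pre km by blast
    have "B2 k k = ext_inner B2 g2 (F (0, x)) (F (k', 0))"
      using km k' e2.gD(6) by (simp add: ext_inner_def)
    also have "\<dots> = 0"
      using Fip[of "(0, x)" "(k', 0)"] x k' V1 e1.gD(6) e1.BD(5) by (simp add: ext_inner_def)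
    finally have "k = 0" using e2.BD(4) km by blast
    then show ?thesis using km by (simp add: S_def)
  qed
  have F_split: "F (k, x) = (\<theta> k, S x)" if "k \<in> K1" "x \<in> M1" for k x
    using lin_map_onD(2)[OF F, of "(k, 0)" "(0, x)"] that F_K F_M V1 by simp
  have \<theta>_in: "\<theta> k \<in> K2" if "k \<in> K1" for k using F_K that by blast
  have S_in: "S x \<in> M2" if "x \<in> M1" for x using F_M that by blast
  have S0: "S 0 = 0" using F_K[OF V1(6)] F_split[OF V1(6) V1(5)] by simp
  have \<theta>0: "\<theta> 0 = 0" using F_M[OF V1(5)] F_split[OF V1(6) V1(5)] by simp
  have Finj: "u = v" if "u \<in> K1 \<times> M1" "v \<in> K1 \<times> M1" "F u = F v" for u v
    using inj_onD[OF bij_betw_imp_inj_on[OF bij]] that by blast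
  have \<theta>_lin: "lin_map_on K1 K2 \<theta>"
    unfolding lin_map_on_def
  proof (intro conjI ballI allI)
    show "\<theta> ` K1 \<subseteq> K2" using \<theta>_in by blast
    show "\<theta> (k + l) = \<theta> k + \<theta> l" if "k \<in> K1" "l \<in> K1" for k l
      using lin_map_onD(2)[OF F, of "(k, 0)" "(l, 0)"] that V1 F_K subspace_add[OF V1(4) that]
      by simp
    show "\<theta> (c *\<^sub>R k) = c *\<^sub>R \<theta> k" if "k \<in> K1" for c k
      using lin_map_onD(3)[OF F, of "(k, 0)" c] that V1 F_K subspace_scale[OF V1(4) that, of c]
      by simp
  qed
  have S_lin: "lin_map_on M1 M2 S"
    unfolding lin_map_on_def
  proof (intro conjI ballI allI)
    show "S ` M1 \<subseteq> M2" using S_in by blast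
    show "S (x + y) = S x + S y" if "x \<in> M1" "y \<in> M1" for x y
      using lin_map_onD(2)[OF F, of "(0, x)" "(0, y)"] that V1 F_M subspace_add[OF V1(3) that]
      by simp
    show "S (c *\<^sub>R x) = c *\<^sub>R S x" if "x \<in> M1" for c x
      using lin_map_onD(3)[OF F, of "(0, x)" c] that V1 F_M subspace_scale[OF V1(3) that, of c]
      by simp
  qed
  have \<theta>_bij: "bij_betw \<theta> K1 K2"
    unfolding bij_betw_def
  proof
    show "inj_on \<theta> K1"
    proof (rule inj_onI)
      fix k l assume kl: "k \<in> K1" "l \<in> K1" "\<theta> k = \<theta> l"
      then show "k = l" using Finj[of "(k, 0)" "(l, 0)"] F_K V1 by simp
    qed
    show "\<theta> ` K1 = K2"
    proof
      show "\<theta> ` K1 \<subseteq> K2" using \<theta>_in by blast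
      show "K2 \<subseteq> \<theta> ` K1"
      proof
        fix k' assume "k' \<in> K2"
        then obtain k where "k \<in> K1" "F (k, 0) = (k', 0)" using K_pre by blast
        then show "k' \<in> \<theta> ` K1" using F_K by auto
      qed
    qed
  qed
  have S_bij: "bij_betw S M1 M2"
    unfolding bij_betw_def
  proof
    show "inj_on S M1"
    proof (rule inj_onI)
      fix x y assume "x \<in> M1" "y \<in> M1" "S x = S y"
      then show "x = y" using Finj[of "(0, x)" "(0, y)"] F_M V1 by simp
    qed
    show "S ` M1 = M2"
    proof
      show "S ` M1 \<subseteq> M2" using S_in by blast
      show "M2 \<subseteq> S ` M1"
      proof
        fix y assume "y \<in> M2"
        then obtain u where "u \<in> K1 \<times> M1" "(0, y) = F u"
          using bij_betw_preimage[OF bij, of "(0, y)"] V2 by auto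
        then show "y \<in> S ` M1" using F_split by (cases u) auto
      qed
    qed
  qed
  have \<theta>_iso: "lin_isometry_on K1 B1 K2 B2 \<theta>"
    unfolding lin_isometry_on_def
  proof (intro conjI ballI \<theta>_lin \<theta>_bij)
    show "B2 (\<theta> k) (\<theta> l) = B1 k l" if "k \<in> K1" "l \<in> K1" for k l
      using Fip[of "(k, 0)" "(l, 0)"] that V1 V2 F_K e1.gD(5) e2.gD(5) by (simp add: ext_inner_def)
  qed
  have S_iso: "lin_isometry_on M1 g1 M2 g2 S"
    unfolding lin_isometry_on_def
  proof (intro conjI ballI S_lin S_bij)
    show "g2 (S x) (S y) = g1 x y" if "x \<in> M1" "y \<in> M1" for x y
      using Fip[of "(0, x)" "(0, y)"] that V1 V2 F_M e1.BD(5) e2.BD(5) by (simp add: ext_inner_def)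
  qed
  \<comment> \<open>Equivariance of the torsion on \<open>\<mm> \<times> \<mm>\<close>, \<open>\<nn> \<times> \<nn>\<close> and \<open>\<nn> \<times> \<mm>\<close>, and then of the curvature on \<open>\<mm>\<close>.\<close>
  have TM: "\<theta> (e1.moment x y) = e2.moment (S x) (S y)
      \<and> S (torsion_of br1 H1 M1 x y) = torsion_of br2 H2 M2 (S x) (S y)"
    if "x \<in> M1" "y \<in> M1" for x y
    using FT[of "(0, x)" "(0, y)"] that V1 F_M S_in e1.ext_torsion_M e2.ext_torsion_M
      F_split[OF e1.moment_in e1.torsion_of_in] by simp
  have TK: "\<theta> (s_bracket k l) = s_bracket (\<theta> k) (\<theta> l)" if "k \<in> K1" "l \<in> K1" for k l
  proof -
    have "\<theta> (2 *\<^sub>R s_bracket k l) = 2 *\<^sub>R s_bracket (\<theta> k) (\<theta> l)"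
      using FT[of "(k, 0)" "(l, 0)"] that V1 F_K e1.ext_torsion_K e2.ext_torsion_K
        subspace_scale[OF V1(4) e1.s_bracket_in] by simp
    then show ?thesis using lin_map_onD(3)[OF \<theta>_lin e1.s_bracket_in[OF that], of 2] by simp
  qed
  have TKM: "S (rep_phi M1 k x) = rep_phi M2 (\<theta> k) (S x)" if "k \<in> K1" "x \<in> M1" for k x
    using FT[of "(k, 0)" "(0, x)"] that V1 F_K F_M e1.ext_torsion_KM e2.ext_torsion_KM
      e1.rep_phi_in[OF that] by simp
  have RM: "S (curvature_of br1 H1 M1 x y z) = curvature_of br2 H2 M2 (S x) (S y) (S z)"
    if xyz: "x \<in> M1" "y \<in> M1" "z \<in> M1" for x y z
  proof -
    let ?r1 = "curvature_of br1 H1 M1 x y z" and ?p1 = "rep_phi M1 (e1.moment x y) z"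
    have mem: "?r1 \<in> M1" "?p1 \<in> M1"
      using e1.curvature_of_selfmaps[OF xyz(1,2)] xyz e1.rep_phi_in e1.moment_in
      by (auto simp: selfmaps_def)
    have in1: "(0, x) \<in> K1 \<times> M1" "(0, y) \<in> K1 \<times> M1" "(0, z) \<in> K1 \<times> M1" using xyz V1 by auto
    have "?R1 (0, x) (0, y) (0, z) \<in> K1 \<times> M1"
      using e1.ext_curvature_selfmaps[OF in1(1,2)] in1 by (simp add: selfmaps_def)
    then have "S (snd (?R1 (0, x) (0, y) (0, z))) = snd (F (?R1 (0, x) (0, y) (0, z)))"
      using F_split by (cases "?R1 (0, x) (0, y) (0, z)") auto
    also have "\<dots> = snd (?R2 (0, S x) (0, S y) (0, S z))" using FR[OF in1] F_M xyz by simp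
    finally have "S ?r1 + S ?p1
      = curvature_of br2 H2 M2 (S x) (S y) (S z) + rep_phi M2 (e2.moment (S x) (S y)) (S z)"
      using xyz S_in mem lin_map_onD(2)[OF S_lin]
      by (simp add: e1.ext_curvature_M e2.ext_curvature_M)
    moreover have "S ?p1 = rep_phi M2 (e2.moment (S x) (S y)) (S z)"
      using TKM TM xyz e1.moment_in by simp
    ultimately show ?thesis by simp
  qed
  obtain \<tau> where \<tau>: "lie_iso G1 br1 G2 br2 \<tau>" "\<tau> ` H1 = H2"
    and \<tau>_S: "\<And>x. x \<in> M1 \<Longrightarrow> \<tau> x = S x"
    by (rule lie_iso_of_model_isometry[OF assms(1-4) S_lin S_bij]) (use TM RM in auto)
  have \<tau>_iso: "lin_isometry_on M1 g1 M2 g2 \<tau>"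
    by (rule lin_isometry_on_cong[OF S_iso V1(3) \<tau>_S])
  \<comment> \<open>Since \<open>\<tau>\<close> is bijective, neither algebra is zero here, so both \<open>\<kk>\<^sub>1\<close> and \<open>\<kk>\<^sub>2\<close> consist of
    derivations; on these \<open>\<tau>\<^sub>*\<close> agrees with \<open>\<theta>\<close>.\<close>
  have "lin_isometry_on K1 B1 K2 B2 (\<lambda>(f, X). (induced_map G1 G2 \<tau> f, X))"
    if nz: "\<not> (G1 = {0} \<and> G2 = {0})"
  proof (rule lin_isometry_on_cong[OF \<theta>_iso V1(4)])
    have \<tau>_lin: "lin_map_on G1 G2 \<tau>" and \<tau>_bij: "bij_betw \<tau> G1 G2"
      using \<tau>(1) by (auto simp: lie_iso_def)
    have nz1: "G1 \<noteq> {0}"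
    proof
      assume "G1 = {0}"
      moreover from this have "G2 = {\<tau> 0}" using \<tau>_bij by (auto simp: bij_betw_def)
      ultimately show False using nz lin_map_on_zero_minus(1)[OF \<tau>_lin V1(1)] by simp
    qed
    have nz2: "G2 \<noteq> {0}"
    proof
      assume "G2 = {0}"
      then have "\<tau> v = \<tau> 0" if "v \<in> G1" for v
        using that lin_map_onD(1)[OF \<tau>_lin] subspace_0[OF V1(1)] by auto
      then have "v = 0" if "v \<in> G1" for v
        using that inj_onD[OF bij_betw_imp_inj_on[OF \<tau>_bij]] subspace_0[OF V1(1)] by blast
      then show False using nz1 subspace_0[OF V1(1)] by blast
    qed
    fix k assume k: "k \<in> K1"
    obtain f X where fX: "k = (f, X)" by (cases k)
    obtain f' X' where fX': "\<theta> k = (f', X')" by (cases "\<theta> k")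
    note s1 = e1.derivation_part[OF nz1 k, unfolded fX fst_conv snd_conv]
    note s2 = e2.derivation_part[OF nz2 \<theta>_in[OF k], unfolded fX' fst_conv snd_conv]
    have "induced_map G1 G2 \<tau> f = f'"
    proof (rule induced_map_eqI[OF \<tau>_bij])
      show "f' y = 0" if "y \<notin> G2" for y using s2(2) that by (auto simp: endos_def)
      fix v assume "v \<in> G1"
      then obtain h x where e: "h \<in> H1" "x \<in> M1" "v = h + x"
        using e1.ds by (auto simp: direct_sum_of_def sum_space_def)
      have m: "h \<in> G1" "x \<in> G1" "\<tau> h \<in> H2" "\<tau> x \<in> M2"
        using e \<tau>(2) \<tau>_S S_in e1.subsets by auto
      have f_lin: "lin_map_on G1 G1 f" and f'_lin: "lin_map_on G2 G2 f'"
        using s1(2) s2(2) by (auto simp: endos_def)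
      have "f' (\<tau> v) = f' (\<tau> h) + f' (\<tau> x)"
        using m e lin_map_onD(2)[OF \<tau>_lin] lin_map_onD(2)[OF f'_lin] e2.subsets by simp
      also have "\<dots> = rep_phi M2 (\<theta> k) (S x)"
        using m s2(3) e \<tau>_S S_in by (simp add: rep_phi_def zero_off_def fX')
      also have "\<dots> = \<tau> (f x)"
        using TKM[OF k e(2)] e \<tau>_S[of "f x"] e1.rep_phi_in[OF k e(2)]
        by (simp add: rep_phi_def zero_off_def fX)
      also have "f x = f v" using m e s1(3) lin_map_onD(2)[OF f_lin] by simp
      finally show "f' (\<tau> v) = \<tau> (f v)" .
    qed
    then show "(case k of (f, X) \<Rightarrow> (induced_map G1 G2 \<tau> f, X)) = \<theta> k"
      using s1(1) s2(1) fX fX' by simp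
  qed
  moreover have "lie_iso K1 s_bracket K2 s_bracket \<theta>"
    using \<theta>_lin \<theta>_bij TK by (simp add: lie_iso_def)
  ultimately show ?thesis using \<tau> \<tau>_iso \<theta>_iso by (intro exI[of _ \<tau>]) auto
qed

end
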